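(* Let $\mathcal{T}$ be a class of finite undirected trees. The following are equivalent: (1) $\mathcal{T}$ is $\mathrm{MSO}_1$-orderable; (2) $\mathcal{T}$ is $\mathrm{MSO}_2$-orderable; (3) $\mathcal{T}$ has property $\mathsf{SEP}$; (4) there is $d\in\mathbb{N}$ such that every tree in $\mathcal{T}$ has maximal degree at most $d$.
   Context: Graphs are finite, simple, loop-free, undirected. For $G=\langle V,E\rangle$: $\lfloor G\rfloor=\langle V,\mathrm{edg}\rangle$ (universe $V$, edge relation) and $\lceil G\rceil=\langle V\cup E,\mathrm{inc}\rangle$ (universe vertices and edges, $\mathrm{inc}\subseteq V\times E$ incidence). An MSO-formula $\varphi(x,y;Z_0,\dots,Z_{n-1})$ defines an order on a class $\mathcal{C}$ of structures if for every non-empty $\mathfrak{A}\in\mathcal{C}$ there are $P_0,\dots,P_{n-1}\subseteq A$ such that $\{(a,b):\mathfrak{A}\models\varphi(a,b;\bar P)\}$ is a linear order on $A$; $\mathcal{C}$ is MSO-orderable if such $\varphi$ exists. A class $\mathcal{C}$ of graphs is $\mathrm{MSO}_1$-orderable if $\{\lfloor G\rfloor:G\in\mathcal{C}\}$ is MSO-orderable and $\mathrm{MSO}_2$-orderable if $\{\lceil G\rceil:G\in\mathcal{C}\}$ is MSO-orderable. $\mathrm{Sep}(G,k)$ is the maximum over vertex sets $S$ with $|S|\le k$ of the number of connected components of $G-S$. A class $\mathcal{C}$ has property $\mathsf{SEP}(f)$ for $f:\mathbb{N}\to\mathbb{N}$ if $\mathrm{Sep}(G,k)\le f(k)$ for all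 $G\in\mathcal{C}$ and $k\in\mathbb{N}$; it has property $\mathsf{SEP}$ if it has $\mathsf{SEP}(f)$ for some $f$. *)

theory Defs
  imports Main
begin

type_synonym 'u mstruct = "'u set \<times> ('u \<Rightarrow> 'u \<Rightarrow> bool)"

datatype mso =
    Rel nat nat
  | Eq nat nat
  | Mem nat nat
  | Neg mso
  | Conj mso mso
  | ExFO nat mso
  | ExSO nat mso

fun sat :: "'u mstruct \<Rightarrow> (nat \<Rightarrow> 'u) \<Rightarrow> (nat \<Rightarrow> 'u set) \<Rightarrow> mso \<Rightarrow> bool" where
  "sat S f g (Rel x y) = snd S (f x) (f y)"
| "sat S f g (Eq x y) = (f x = f y)"
| "sat S f g (Mem x X) = (f x \<in> g X)"
| "sat S f g (Neg \<phi>) = (\<not> sat S f g \<phi>)"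
| "sat S f g (Conj \<phi> \<psi>) = (sat S f g \<phi> \<and> sat S f g \<psi>)"
| "sat S f g (ExFO x \<phi>) = (\<exists>a\<in>fst S. sat S (f(x := a)) g \<phi>)"
| "sat S f g (ExSO X \<phi>) = (\<exists>P. P \<subseteq> fst S \<and> sat S f (g(X := P)) \<phi>)"

fun fvFO :: "mso \<Rightarrow> nat set" where
  "fvFO (Rel x y) = {x, y}"
| "fvFO (Eq x y) = {x, y}"
| "fvFO (Mem x X) = {x}"
| "fvFO (Neg \<phi>) = fvFO \<phi>"
| "fvFO (Conj \<phi> \<psi>) = fvFO \<phi> \<union> fvFO \<psi>"
| "fvFO (ExFO x \<phi>) = fvFO \<phi> - {x}"
| "fvFO (ExSO X \<phi>) = fvFO \<phi>"

fun fvSO :: "mso \<Rightarrow> nat set" where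
  "fvSO (Rel x y) = {}"
| "fvSO (Eq x y) = {}"
| "fvSO (Mem x X) = {X}"
| "fvSO (Neg \<phi>) = fvSO \<phi>"
| "fvSO (Conj \<phi> \<psi>) = fvSO \<phi> \<union> fvSO \<psi>"
| "fvSO (ExFO x \<phi>) = fvSO \<phi>"
| "fvSO (ExSO X \<phi>) = fvSO \<phi> - {X}"

text \<open>\<phi>(x,y;Z_0,...,Z_{n-1}) with x = FO variable 0, y = FO variable 1, Z_i = set variable i.
  It defines an order on the class C if for every non-empty structure in C there are
  parameters P_0,...,P_{n-1} \<subseteq> A such that the defined relation is a linear order on A.\<close>

definition defines_order :: "mso \<Rightarrow> nat \<Rightarrow> 'u mstruct set \<Rightarrow> bool" where
  "defines_order \<phi> n C \<longleftrightarrow>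
     fvFO \<phi> \<subseteq> {0, 1} \<and> fvSO \<phi> \<subseteq> {..<n} \<and>
     (\<forall>S\<in>C. fst S \<noteq> {} \<longrightarrow>
        (\<exists>P :: nat \<Rightarrow> 'u set. (\<forall>i<n. P i \<subseteq> fst S) \<and>
           linear_order_on (fst S)
             {(a, b). a \<in> fst S \<and> b \<in> fst S \<and>
                      sat S (\<lambda>i. if i = 0 then a else b) P \<phi>}))"

definition MSO_orderable :: "'u mstruct set \<Rightarrow> bool" where
  "MSO_orderable C \<longleftrightarrow> (\<exists>\<phi> n. defines_order \<phi> n C)"

type_synonym 'v graph = "'v set \<times> 'v set set"

definition is_graph :: "'v graph \<Rightarrow> bool" where
  "is_graph G \<longleftrightarrow> finite (fst G) \<and> (\<forall>e\<in>snd G. e \<subseteq> fst G \<and> card e = 2)"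

definition adj :: "'v graph \<Rightarrow> 'v \<Rightarrow> 'v \<Rightarrow> bool" where
  "adj G u v \<longleftrightarrow> {u, v} \<in> snd G"

definition connected :: "'v graph \<Rightarrow> bool" where
  "connected G \<longleftrightarrow> (\<forall>u\<in>fst G. \<forall>v\<in>fst G. (adj G)\<^sup>*\<^sup>* u v)"

definition has_cycle :: "'v graph \<Rightarrow> bool" where
  "has_cycle G \<longleftrightarrow> (\<exists>vs. length vs \<ge> 3 \<and> distinct vs \<and> set vs \<subseteq> fst G \<and>
      (\<forall>i < length vs - 1. adj G (vs ! i) (vs ! (i + 1))) \<and>
      adj G (last vs) (hd vs))"

definition is_tree :: "'v graph \<Rightarrow> bool" where
  "is_tree G \<longleftrightarrow> is_graph G \<and> fst G \<noteq> {} \<and> connected G \<and> \<not> has_cycle G"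

definition degree :: "'v graph \<Rightarrow> 'v \<Rightarrow> nat" where
  "degree G v = card {e \<in> snd G. v \<in> e}"

definition floor_str :: "'v graph \<Rightarrow> 'v mstruct" where
  "floor_str G = (fst G, adj G)"

definition ceil_str :: "'v graph \<Rightarrow> ('v + 'v set) mstruct" where
  "ceil_str G = (Inl ` fst G \<union> Inr ` snd G,
                 \<lambda>x y. \<exists>v e. x = Inl v \<and> y = Inr e \<and> v \<in> fst G \<and> e \<in> snd G \<and> v \<in> e)"

definition MSO1_orderable :: "'v graph set \<Rightarrow> bool" where
  "MSO1_orderable C \<longleftrightarrow> MSO_orderable (floor_str ` C)"

definition MSO2_orderable :: "'v graph set \<Rightarrow> bool" where
  "MSO2_orderable C \<longleftrightarrow> MSO_orderable (ceil_str ` C)"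

definition delete_vertices :: "'v graph \<Rightarrow> 'v set \<Rightarrow> 'v graph" where
  "delete_vertices G S = (fst G - S, {e \<in> snd G. e \<inter> S = {}})"

definition components :: "'v graph \<Rightarrow> 'v set set" where
  "components G = fst G // {(u, v). u \<in> fst G \<and> v \<in> fst G \<and> (adj G)\<^sup>*\<^sup>* u v}"

definition Sep :: "'v graph \<Rightarrow> nat \<Rightarrow> nat" where
  "Sep G k = Max {card (components (delete_vertices G S)) | S. S \<subseteq> fst G \<and> card S \<le> k}"

definition has_SEP :: "'v graph set \<Rightarrow> bool" where
  "has_SEP C \<longleftrightarrow> (\<exists>f :: nat \<Rightarrow> nat. \<forall>G\<in>C. \<forall>k. Sep G k \<le> f k)"

end

theory Submission
  imports Defs
begin

text \<open>Bounded degree implies orderability for every class of finite connected structures: colour the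
  elements so that any two neighbours of a common element differ, choose a breadth-first spanning
  tree, and order the elements lexicographically by the colours along their paths from the root.
  Finitely many set parameters encode the colours and the parents. Conversely, if a vertex of a tree
  has more neighbours than there are pairs of MSO-types, two of the branches at this vertex have the
  same types, and by an Ehrenfeucht-Fraisse argument interchanging them preserves the formula, which
  therefore cannot order their chosen points. Finally, a vertex of degree \<open>d\<close> in a tree separates it into
  \<open>d\<close> components, while deleting \<open>k\<close> vertices of degree at most \<open>d\<close> leaves at most \<open>k d + 1\<close>.\<close>

section \<open>Ordering connected structures of bounded degree\<close>

text \<open>The lexicographic order is MSO-definable because it needs only two relations on the
  spanning tree: ancestry, which is a closure condition on sets, and being siblings of smaller and
  larger colour. The parent relation costs only colours: no two neighbours of an element share a
  colour, so recording the parent's colour singles the parent out, and no orientation has to be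
  stored. In the converse direction, two branches of equal type need not be isomorphic, so
  interchanging them is no automorphism but a strategy in a game in which each branch sees only its
  own trace of the valuation. Comparing \<open>(a, b)\<close> with \<open>(b, a)\<close> involves
  two views of a branch, one where it holds the first value and one where it holds the second; hence
  pairs of types. The number of types must be finite over all structures at once, since it becomes
  the degree bound. So that one argument serves both structures of a graph, a branch is known only
  through an interface: one marked set inside, and fixed sets outside for each direction of the
  relation.\<close>

definition Disj :: "mso \<Rightarrow> mso \<Rightarrow> mso" where
  "Disj \<phi> \<psi> = Neg (Conj (Neg \<phi>) (Neg \<psi>))"

text \<open>The syntax has no falsum, so the empty disjunction is \<open>Neg (Eq 0 0)\<close>. This
  makes variable 0 free, which is harmless: 0 is one of the two variables that may be free in the
  end.\<close>

definition BigDisj :: "mso list \<Rightarrow> mso" where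
  "BigDisj \<phi>s = foldr Disj \<phi>s (Neg (Eq 0 0))"

lemma sat_Disj [simp]: "sat S f g (Disj \<phi> \<psi>) \<longleftrightarrow> sat S f g \<phi> \<or> sat S f g \<psi>"
  by (simp add: Disj_def)

lemma fv_Disj [simp]:
  "fvFO (Disj \<phi> \<psi>) = fvFO \<phi> \<union> fvFO \<psi>" "fvSO (Disj \<phi> \<psi>) = fvSO \<phi> \<union> fvSO \<psi>"
  by (simp_all add: Disj_def)

lemma sat_BigDisj [simp]: "sat S f g (BigDisj \<phi>s) \<longleftrightarrow> (\<exists>\<phi>\<in>set \<phi>s. sat S f g \<phi>)"
  unfolding BigDisj_def by (induction \<phi>s) auto

lemma fv_BigDisj [simp]:
  "fvFO (BigDisj \<phi>s) = insert 0 (\<Union>\<phi>\<in>set \<phi>s. fvFO \<phi>)"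
  "fvSO (BigDisj \<phi>s) = (\<Union>\<phi>\<in>set \<phi>s. fvSO \<phi>)"
  unfolding BigDisj_def by (induction \<phi>s) auto

text \<open>Set variable \<open>i < K\<close> holds the vertices of colour \<open>i\<close>, and set variable \<open>K + i\<close> those whose
  parent has colour \<open>i\<close>.\<close>

definition child_fm :: "nat \<Rightarrow> nat \<Rightarrow> nat \<Rightarrow> mso" where
  "child_fm K p x = Conj (Disj (Rel p x) (Rel x p))
     (BigDisj (map (\<lambda>i. Conj (Mem p i) (Mem x (K + i))) [0..<K]))"

definition colour_less_fm :: "nat \<Rightarrow> nat \<Rightarrow> nat \<Rightarrow> mso" where
  "colour_less_fm K s t = BigDisj [Conj (Mem s i) (Mem t j). j \<leftarrow> [0..<K], i \<leftarrow> [0..<j]]"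

definition ancestor_fm :: "nat \<Rightarrow> nat \<Rightarrow> nat \<Rightarrow> mso" where
  "ancestor_fm K x y = Neg (ExSO (2 * K) (Conj (Mem x (2 * K)) (Conj (Neg (Mem y (2 * K)))
     (Neg (ExFO 5 (ExFO 6 (Conj (Mem 5 (2 * K)) (Conj (child_fm K 5 6) (Neg (Mem 6 (2 * K)))))))))))"

text \<open>Variables 2 and 3 are the siblings, with parent 4, at which the paths to the two
  compared elements fork.\<close>

definition lex_fm :: "nat \<Rightarrow> mso" where
  "lex_fm K = Disj (ancestor_fm K 0 1)
     (ExFO 2 (ExFO 3 (ExFO 4 (Conj (child_fm K 4 2) (Conj (child_fm K 4 3)
       (Conj (colour_less_fm K 2 3) (Conj (ancestor_fm K 2 0) (ancestor_fm K 3 1))))))))"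

lemma fv_lex_fm: "fvFO (lex_fm K) \<subseteq> {0, 1}" "fvSO (lex_fm K) \<subseteq> {..<2 * K}"
  by (auto simp: lex_fm_def ancestor_fm_def colour_less_fm_def child_fm_def)

text \<open>Symmetrised, because incidence relates vertices to edges in one direction only.\<close>

definition nbr :: "'u mstruct \<Rightarrow> 'u \<Rightarrow> 'u \<Rightarrow> bool" where
  "nbr S a b \<longleftrightarrow> a \<in> fst S \<and> b \<in> fst S \<and> (snd S a b \<or> snd S b a)"

lemma nbr_sym: "nbr S a b \<Longrightarrow> nbr S b a"
  by (auto simp: nbr_def)

text \<open>Adjacency is undirected; the direction comes from the colour that \<open>x\<close>
  records for its parent.\<close>

definition child_of :: "'u mstruct \<Rightarrow> nat \<Rightarrow> (nat \<Rightarrow> 'u set) \<Rightarrow> 'u \<Rightarrow> 'u \<Rightarrow> bool" where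
  "child_of S K g p x \<longleftrightarrow> nbr S p x \<and> (\<exists>i<K. p \<in> g i \<and> x \<in> g (K + i))"

lemma sat_child_fm:
  "f p \<in> fst S \<Longrightarrow> f x \<in> fst S \<Longrightarrow> sat S f g (child_fm K p x) \<longleftrightarrow> child_of S K g (f p) (f x)"
  by (auto simp: child_fm_def child_of_def nbr_def)

lemma child_of_upd [simp]: "child_of S K (g(2 * K := X)) = child_of S K g"
  unfolding child_of_def by (intro ext conj_cong ex_cong1 refl) auto

lemma sat_colour_less_fm:
  "sat S f g (colour_less_fm K s t) \<longleftrightarrow> (\<exists>j<K. \<exists>i<j. f s \<in> g i \<and> f t \<in> g j)"
  by (auto simp: colour_less_fm_def) (blast, force)

text \<open>The bounds on \<open>x\<close> and \<open>y\<close> keep the bound variables 5 and 6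
  from capturing them.\<close>

lemma sat_ancestor_fm:
  assumes "f x \<in> fst S" "f y \<in> fst S" "x < 5" "y < 5"
  shows "sat S f g (ancestor_fm K x y) \<longleftrightarrow> (child_of S K g)\<^sup>*\<^sup>* (f x) (f y)"
proof -
  let ?C = "child_of S K g"
  have inA: "?C u v \<Longrightarrow> u \<in> fst S \<and> v \<in> fst S" for u v
    by (auto simp: child_of_def nbr_def)
  have "sat S f g (ancestor_fm K x y) \<longleftrightarrow>
    (\<forall>X. X \<subseteq> fst S \<longrightarrow> f x \<in> X \<longrightarrow> f y \<notin> X \<longrightarrow> (\<exists>u\<in>fst S. \<exists>v\<in>fst S. u \<in> X \<and> ?C u v \<and> v \<notin> X))"
    (is "_ \<longleftrightarrow> ?R") unfolding ancestor_fm_def using assms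
    by (simp add: sat_child_fm) (intro all_cong1, blast)
  also have "?R \<longleftrightarrow> ?C\<^sup>*\<^sup>* (f x) (f y)"
  proof
    assume R: ?R
    \<comment> \<open>The least closed set is the one to instantiate with; it has to lie in the
      universe to be a legal value of the set quantifier.\<close>
    have "{z. ?C\<^sup>*\<^sup>* (f x) z} \<subseteq> fst S"
      using assms(1) inA by (auto elim: rtranclp.cases)
    with R show "?C\<^sup>*\<^sup>* (f x) (f y)"
      by (auto dest!: spec[of _ "{z. ?C\<^sup>*\<^sup>* (f x) z}"] intro: rtranclp.rtrancl_into_rtrancl)
  next
    assume c: "?C\<^sup>*\<^sup>* (f x) (f y)"
    show ?R
    proof (intro allI impI, rule ccontr)
      fix X assume "f x \<in> X" "f y \<notin> X"
        and cl: "\<not> (\<exists>u\<in>fst S. \<exists>v\<in>fst S. u \<in> X \<and> ?C u v \<and> v \<notin> X)"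
      from c \<open>f x \<in> X\<close> have "f y \<in> X" by (induction) (use cl inA in blast)+
      with \<open>f y \<notin> X\<close> show False ..
    qed
  qed
  finally show ?thesis .
qed

lemma sat_lex_fm:
  fixes S :: "'u mstruct" and K and g
  assumes "f 0 \<in> fst S" "f 1 \<in> fst S"
  defines "C \<equiv> child_of S K g"
  shows "sat S f g (lex_fm K) \<longleftrightarrow> C\<^sup>*\<^sup>* (f 0) (f 1) \<or>
    (\<exists>s t q. C q s \<and> C q t \<and> (\<exists>j<K. \<exists>i<j. s \<in> g i \<and> t \<in> g j) \<and> C\<^sup>*\<^sup>* s (f 0) \<and> C\<^sup>*\<^sup>* t (f 1))"
proof -
  have inA: "C u v \<Longrightarrow> u \<in> fst S \<and> v \<in> fst S" for u v
    by (auto simp: child_of_def nbr_def C_def)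
  show ?thesis
    unfolding lex_fm_def using assms(1,2) inA
    by (simp add: sat_child_fm sat_ancestor_fm sat_colour_less_fm C_def) blast
qed

section \<open>Lexicographic comparison of colour words\<close>

locale coloured_tree =
  fixes A :: "'a set" and r :: 'a and par :: "'a \<Rightarrow> 'a" and lev col :: "'a \<Rightarrow> nat"
  assumes root: "r \<in> A" "lev r = 0"
    and par: "x \<in> A \<Longrightarrow> x \<noteq> r \<Longrightarrow> par x \<in> A \<and> lev x = Suc (lev (par x))"
    and siblings: "\<lbrakk>x \<in> A; y \<in> A; x \<noteq> r; y \<noteq> r; par x = par y; col x = col y\<rbrakk> \<Longrightarrow> x = y"
begin

definition child :: "'a \<Rightarrow> 'a \<Rightarrow> bool" where
  "child p x \<longleftrightarrow> x \<in> A \<and> x \<noteq> r \<and> p = par x"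

text \<open>The depth serves as the recursion argument, as \<open>par\<close> alone gives no
  structural descent. Letters are appended on the right, so that words are read from the root and
  common prefixes stand for common ancestors.\<close>

primrec path :: "nat \<Rightarrow> 'a \<Rightarrow> nat list" where
  "path 0 x = []"
| "path (Suc n) x = path n (par x) @ [col x]"

definition word :: "'a \<Rightarrow> nat list" where
  "word x = path (lev x) x"

lemma word_root [simp]: "word r = []"
  by (simp add: word_def root)

lemma word_nonroot: "x \<in> A \<Longrightarrow> x \<noteq> r \<Longrightarrow> word x = word (par x) @ [col x]"
  by (simp add: word_def par)

lemma word_inj: "x \<in> A \<Longrightarrow> y \<in> A \<Longrightarrow> word x = word y \<Longrightarrow> x = y"
proof (induction "lev x" arbitrary: x y rule: less_induct)
  case less
  show ?case
  proof (cases "x = r \<or> y = r")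
    case True
    then show ?thesis using less.prems word_nonroot by (metis Nil_is_append_conv not_Cons_self2 word_root)
  next
    case False
    then have "word (par x) = word (par y)" "col x = col y"
      using less.prems by (auto simp: word_nonroot)
    moreover have "par x = par y"
      using less.hyps[of "par x" "par y"] False less.prems par[of x] par[of y] calculation by auto
    ultimately show ?thesis using siblings False less.prems by blast
  qed
qed

text \<open>Pass to parents until \<open>w\<close> is used up, each step removing one letter.
  Together with \<open>word_inj\<close> this turns prefixes into ancestors.\<close>

lemma word_prefix: "b \<in> A \<Longrightarrow> word b = u @ w \<Longrightarrow> \<exists>a\<in>A. word a = u \<and> child\<^sup>*\<^sup>* a b"
proof (induction "lev b" arbitrary: b w rule: less_induct)
  case less
  show ?case
  proof (cases w rule: rev_cases)
    case Nil
    then show ?thesis using less.prems by auto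
  next
    case (snoc w' c)
    then have b: "b \<noteq> r" using less.prems by auto
    then have "word (par b) = u @ w'" using snoc less.prems by (simp add: word_nonroot)
    then obtain a where "a \<in> A" "word a = u" "child\<^sup>*\<^sup>* a (par b)"
      using less.hyps[of "par b" w'] par[of b] b less.prems by auto
    moreover have "child (par b) b" using b less.prems by (simp add: child_def)
    ultimately show ?thesis by (metis rtranclp.rtrancl_into_rtrancl)
  qed
qed

lemma word_descendant: "child\<^sup>*\<^sup>* a b \<Longrightarrow> \<exists>w. word b = word a @ w"
  by (induction rule: rtranclp_induct) (auto simp: child_def word_nonroot)

text \<open>A word precedes another either as a prefix, which means ancestry, or at a first
  differing letter, which is a fork between two siblings. The right-hand side mentions no words and
  is what \<open>lex_fm\<close> expresses.\<close>

lemma word_lexord_iff: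
  assumes "a \<in> A" "b \<in> A"
  shows "a = b \<or> (word a, word b) \<in> lexord less_than \<longleftrightarrow>
    child\<^sup>*\<^sup>* a b \<or> (\<exists>s t q. child q s \<and> child q t \<and> col s < col t \<and> child\<^sup>*\<^sup>* s a \<and> child\<^sup>*\<^sup>* t b)"
    (is "?L \<longleftrightarrow> ?R")
proof
  assume ?L
  then consider "a = b" | x v where "word b = word a @ x # v"
    | u x y v w where "x < y" "word a = u @ x # v" "word b = u @ y # w"
    by (auto simp: lexord_def)
  then show ?R
  proof cases
    case 1
    then show ?thesis by simp
  next
    case 2
    then obtain c where "c \<in> A" "word c = word a" "child\<^sup>*\<^sup>* c b" using word_prefix assms(2) by blast
    then show ?thesis using word_inj assms(1) by blast
  next
    case 3
    \<comment> \<open>The nodes reached just after the first difference; both parents have the word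
      \<open>u\<close>, so they coincide.\<close>
    obtain s where s: "s \<in> A" "word s = u @ [x]" "child\<^sup>*\<^sup>* s a"
      using word_prefix[of a "u @ [x]" v] assms 3 by auto
    obtain t where t: "t \<in> A" "word t = u @ [y]" "child\<^sup>*\<^sup>* t b"
      using word_prefix[of b "u @ [y]" w] assms 3 by auto
    have nr: "s \<noteq> r" "t \<noteq> r" using s t by auto
    then have "word (par s) = u" "word (par t) = u" "col s = x" "col t = y"
      using s t word_nonroot[of s] word_nonroot[of t] by auto
    then have "par s = par t" using word_inj par s t nr by metis
    then have "child (par s) s" "child (par s) t" using s t nr by (auto simp: child_def)
    moreover have "col s < col t" using \<open>x < y\<close> \<open>col s = x\<close> \<open>col t = y\<close> by simp
    ultimately show ?thesis using s(3) t(3) by blast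
  qed
next
  assume ?R
  then show ?L
  proof
    assume "child\<^sup>*\<^sup>* a b"
    then obtain w where w: "word b = word a @ w" using word_descendant by blast
    then show ?L using word_inj[OF assms] by (cases w) (auto intro: lexord_append_rightI)
  next
    assume "\<exists>s t q. child q s \<and> child q t \<and> col s < col t \<and> child\<^sup>*\<^sup>* s a \<and> child\<^sup>*\<^sup>* t b"
    then obtain s t q where st: "child q s" "child q t" "col s < col t" "child\<^sup>*\<^sup>* s a" "child\<^sup>*\<^sup>* t b"
      by blast
    obtain v w where "word a = word s @ v" "word b = word t @ w"
      using word_descendant st by blast
    moreover have "word s = word q @ [col s]" "word t = word q @ [col t]"
      using st word_nonroot by (auto simp: child_def)
    ultimately show ?L using st(3) by (simp add: lexord_append_left_rightI)
  qed
qed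

lemma linear_order_word:
  "linear_order_on A {(a, b). a \<in> A \<and> b \<in> A \<and> (a = b \<or> (word a, word b) \<in> lexord less_than)}"
proof -
  have tr: "trans (lexord (less_than :: (nat \<times> nat) set))" by (simp add: lexord_trans lexord_transI)
  have asym: "(x, y) \<in> lexord less_than \<Longrightarrow> (y, x) \<notin> lexord less_than" for x y :: "nat list"
    using lexord_asym[OF asym_less_than] by (auto dest: asymD)
  have tot: "(x, y) \<in> lexord less_than \<or> x = y \<or> (y, x) \<in> lexord less_than" for x y :: "nat list"
    by (rule lexord_linear) auto
  let ?r = "{(a, b). a \<in> A \<and> b \<in> A \<and> (a = b \<or> (word a, word b) \<in> lexord less_than)}"
  have "refl_on A ?r" by (auto simp: refl_on_def)
  moreover have "trans ?r" by (rule transI) (auto dest: transD[OF tr])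
  moreover have "antisym ?r" using asym by (auto simp: antisym_def)
  moreover have "total_on A ?r" unfolding total_on_def using tot word_inj by fastforce
  ultimately show ?thesis
    unfolding linear_order_on_def partial_order_on_def preorder_on_def by auto
qed

end

section \<open>Colourings and breadth-first trees\<close>

text \<open>Greedy colouring: an element conflicts only with elements two steps away, of which there
  are at most \<open>d * d\<close>, so one further colour suffices.\<close>

lemma distance_two_colouring:
  fixes E :: "'a \<Rightarrow> 'a \<Rightarrow> bool"
  assumes "finite A" and sym: "\<And>a b. E a b \<Longrightarrow> E b a"
    and deg: "\<And>a. a \<in> A \<Longrightarrow> finite {b. E a b} \<and> card {b. E a b} \<le> d"
    and EA: "\<And>a b. E a b \<Longrightarrow> a \<in> A"
  shows "\<exists>col :: 'a \<Rightarrow> nat. (\<forall>a. col a < Suc (d * d)) \<and>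
    (\<forall>x a b. E x a \<longrightarrow> E x b \<longrightarrow> col a = col b \<longrightarrow> a = b)"
proof -
  \<comment> \<open>Only conflicts inside \<open>B\<close> are excluded, while the common neighbour
    \<open>x\<close> is unrestricted; it may be coloured later or never.\<close>
  have "\<exists>col :: 'a \<Rightarrow> nat. (\<forall>a. col a < Suc (d * d)) \<and>
    (\<forall>x. \<forall>a\<in>B. \<forall>b\<in>B. E x a \<longrightarrow> E x b \<longrightarrow> col a = col b \<longrightarrow> a = b)" if "finite B" "B \<subseteq> A" for B
    using that
  proof (induction B rule: finite_induct)
    case empty
    then show ?case by (intro exI[of _ "\<lambda>_. 0"]) simp
  next
    case (insert c B)
    then have "B \<subseteq> A" by simp
    from insert.IH[OF this] obtain col :: "'a \<Rightarrow> nat" where col: "\<forall>a. col a < Suc (d * d)"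
      "\<forall>x. \<forall>a\<in>B. \<forall>b\<in>B. E x a \<longrightarrow> E x b \<longrightarrow> col a = col b \<longrightarrow> a = b"
      by (elim exE conjE) (rule that)
    let ?Z = "\<Union>x\<in>{x. E c x}. {b. E x b}"
    have cA: "c \<in> A" and EA': "\<And>x. E c x \<Longrightarrow> x \<in> A" using insert.prems EA sym by blast+
    have fZ: "finite ?Z" using deg[OF cA] deg[OF EA'] by auto
    have "card ?Z \<le> (\<Sum>x\<in>{x. E c x}. card {b. E x b})"
      using deg[OF cA] by (intro card_UN_le) auto
    also have "\<dots> \<le> (\<Sum>x\<in>{x. E c x}. d)"
      using deg[OF EA'] by (intro sum_mono) simp
    also have "\<dots> \<le> d * d" using deg[OF cA] by simp
    finally have "card (col ` ?Z) < card {..<Suc (d * d)}"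
      using card_image_le[OF fZ, of col] by simp
    then obtain k where k: "k < Suc (d * d)" "k \<notin> col ` ?Z"
      using fZ by (metis card_mono finite_imageI leD lessThan_iff subsetI)
    have Z: "b \<in> ?Z" if "E x c" "E x b" for x b using that sym by blast
    have new: "col b \<noteq> k" if "E x c" "E x b" for x b using Z[OF that] k(2) by blast
    have "a = b" if "a \<in> insert c B" "b \<in> insert c B" "E x a" "E x b" "(col(c := k)) a = (col(c := k)) b" for x a b
      using that col(2) new[of x a] new[of x b] by (auto split: if_splits)
    then have "\<forall>x. \<forall>a\<in>insert c B. \<forall>b\<in>insert c B. E x a \<longrightarrow> E x b \<longrightarrow> (col(c := k)) a = (col(c := k)) b \<longrightarrow> a = b"
      by blast
    moreover have "\<forall>a. (col(c := k)) a < Suc (d * d)" using col(1) k(1) by simp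
    ultimately show ?case by (intro exI conjI)
  qed
  from this[OF assms(1) order_refl] obtain col :: "'a \<Rightarrow> nat" where "\<forall>a. col a < Suc (d * d)"
    "\<forall>x. \<forall>a\<in>A. \<forall>b\<in>A. E x a \<longrightarrow> E x b \<longrightarrow> col a = col b \<longrightarrow> a = b" by blast
  moreover have "b \<in> A" if "E a b" for a b using EA sym that by blast
  ultimately show ?thesis by blast
qed

text \<open>The level is the length of a shortest walk from \<open>r\<close>, and the parent is the
  last but one element of such a walk.\<close>

lemma bfs_parent:
  fixes E :: "'a \<Rightarrow> 'a \<Rightarrow> bool"
  assumes con: "\<And>x. x \<in> A \<Longrightarrow> E\<^sup>*\<^sup>* r x"
  shows "\<exists>par lev. lev r = (0::nat) \<and> (\<forall>x\<in>A. x \<noteq> r \<longrightarrow> E (par x) x \<and> lev x = Suc (lev (par x)))"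
proof -
  define lev where "lev x = (LEAST n. (E ^^ n) r x)" for x
  have reach: "(E ^^ lev x) r x" if "x \<in> A" for x
    using con[OF that] unfolding lev_def rtranclp_power by (auto intro: LeastI)
  have "\<exists>p. E p x \<and> lev x = Suc (lev p)" if x: "x \<in> A" "x \<noteq> r" for x
  proof -
    obtain n where n: "lev x = Suc n" using reach[OF x(1)] x(2) by (cases "lev x") auto
    then obtain p where p: "(E ^^ n) r p" "E p x" using reach[OF x(1)] by auto
    then have "(E ^^ lev p) r p" "lev p \<le> n" by (auto simp: lev_def intro: LeastI Least_le)
    \<comment> \<open>Prolonging a shortest walk to \<open>p\<close> by one edge gives the
      inequality opposite to \<open>lev p \<le> n\<close>.\<close>
    then have "(E ^^ Suc (lev p)) r x" using p by auto
    then have "lev x \<le> Suc (lev p)" unfolding lev_def[of x] by (rule Least_le)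
    then show ?thesis using n p \<open>lev p \<le> n\<close> by auto
  qed
  then obtain par where "\<forall>x\<in>A. x \<noteq> r \<longrightarrow> E (par x) x \<and> lev x = Suc (lev (par x))" by metis
  moreover have "lev r = 0" unfolding lev_def by (rule Least_eq_0) simp
  ultimately show ?thesis by blast
qed

text \<open>Stated for arbitrary structures so that it applies to adjacency and incidence structures
  alike; the formula depends on \<open>d\<close> only.\<close>

lemma bounded_degree_orderable:
  fixes C :: "'u mstruct set"
  assumes fin: "\<And>S. S \<in> C \<Longrightarrow> finite (fst S)"
    and con: "\<And>S a b. S \<in> C \<Longrightarrow> a \<in> fst S \<Longrightarrow> b \<in> fst S \<Longrightarrow> (nbr S)\<^sup>*\<^sup>* a b"
    and deg: "\<And>S a. S \<in> C \<Longrightarrow> a \<in> fst S \<Longrightarrow> card {b. nbr S a b} \<le> d"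
  shows "MSO_orderable C"
proof -
  define K where "K = Suc (d * d)"
  have "\<exists>P. (\<forall>i<2 * K. P i \<subseteq> fst S) \<and> linear_order_on (fst S)
      {(a, b). a \<in> fst S \<and> b \<in> fst S \<and> sat S (\<lambda>i. if i = 0 then a else b) P (lex_fm K)}"
    if S: "S \<in> C" "fst S \<noteq> {}" for S
  proof -
    let ?A = "fst S" and ?E = "nbr S"
    obtain r where r: "r \<in> ?A" using S by blast
    have "finite {b. ?E a b}" for a
      by (rule finite_subset[OF _ fin[OF S(1)]]) (auto simp: nbr_def)
    then have "\<exists>col. (\<forall>a. col a < K) \<and> (\<forall>x a b. ?E x a \<longrightarrow> ?E x b \<longrightarrow> col a = col b \<longrightarrow> a = b)"
      unfolding K_def using fin[OF S(1)] deg[OF S(1)]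
      by (intro distance_two_colouring[of ?A]) (auto simp: nbr_def)
    then obtain col where col: "\<And>a. col a < K" "\<And>x a b. ?E x a \<Longrightarrow> ?E x b \<Longrightarrow> col a = col b \<Longrightarrow> a = b"
      by blast
    obtain par lev where lev: "lev r = (0::nat)"
      and parE: "\<And>x. x \<in> ?A \<Longrightarrow> x \<noteq> r \<Longrightarrow> ?E (par x) x \<and> lev x = Suc (lev (par x))"
      using bfs_parent[of ?A ?E r] con[OF S(1) r] by auto
    \<comment> \<open>Siblings are neighbours of their common parent, so the colouring separates
      them.\<close>
    interpret coloured_tree ?A r par lev col
      by unfold_locales (use r lev parE col(2) in \<open>auto simp: nbr_def\<close>, metis col(2) parE)
    \<comment> \<open>The root is left out of all sets with index at least \<open>K\<close>, so it
      is nobody's child.\<close>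
    define P where "P i = (if i < K then {x \<in> ?A. col x = i}
        else {x \<in> ?A. x \<noteq> r \<and> col (par x) = i - K})" for i
    have PC: "x \<in> P i \<longleftrightarrow> x \<in> ?A \<and> col x = i" if "i < K" for x i using that by (simp add: P_def)
    have PP: "x \<in> P (K + i) \<longleftrightarrow> x \<in> ?A \<and> x \<noteq> r \<and> col (par x) = i" for x i by (simp add: P_def)
    have "child_of S K P p x \<longleftrightarrow> child p x" for p x
    proof
      assume "child_of S K P p x"
      then have "?E p x" "x \<in> ?A" "x \<noteq> r" "col p = col (par x)"
        by (auto simp: child_of_def PC PP)
      \<comment> \<open>Both \<open>p\<close> and \<open>par x\<close> are neighbours of
        \<open>x\<close> and have the same colour, so they are equal.\<close>
      then show "child p x" using col(2) parE nbr_sym unfolding child_def by metis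
    next
      assume "child p x"
      then show "child_of S K P p x"
        using parE[of x] col(1)[of p] by (auto simp: child_of_def child_def PC PP nbr_def)
    qed
    then have ch: "child_of S K P = child" by (simp add: fun_eq_iff)
    have cl: "(\<exists>j<K. \<exists>i<j. s \<in> P i \<and> t \<in> P j) \<longleftrightarrow> s \<in> ?A \<and> t \<in> ?A \<and> col s < col t" for s t
    proof
      assume "\<exists>j<K. \<exists>i<j. s \<in> P i \<and> t \<in> P j"
      then obtain i j where "j < K" "i < j" "s \<in> P i" "t \<in> P j" by blast
      then show "s \<in> ?A \<and> t \<in> ?A \<and> col s < col t" using PC[of i s] PC[of j t] by auto
    next
      assume "s \<in> ?A \<and> t \<in> ?A \<and> col s < col t"
      then show "\<exists>j<K. \<exists>i<j. s \<in> P i \<and> t \<in> P j"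
        using col(1)[of s] col(1)[of t] PC[of "col s" s] PC[of "col t" t] by blast
    qed
    have "sat S (\<lambda>i. if i = 0 then a else b) P (lex_fm K) \<longleftrightarrow> a = b \<or> (word a, word b) \<in> lexord less_than"
      if "a \<in> ?A" "b \<in> ?A" for a b
      unfolding word_lexord_iff[OF that] using that by (simp add: sat_lex_fm ch cl) (metis child_def)
    then have "{(a, b). a \<in> ?A \<and> b \<in> ?A \<and> sat S (\<lambda>i. if i = 0 then a else b) P (lex_fm K)} =
       {(a, b). a \<in> ?A \<and> b \<in> ?A \<and> (a = b \<or> (word a, word b) \<in> lexord less_than)}"
      by (intro Collect_cong) auto
    then show ?thesis using linear_order_word
      by (intro exI[of _ P]) (auto simp: P_def)
  qed
  then show ?thesis unfolding MSO_orderable_def defines_order_def using fv_lex_fm by blast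
qed

section \<open>Interchanging equivalent branches\<close>

text \<open>A part \<open>A\<close> of a structure with relation \<open>R\<close>, where \<open>M\<close> marks the elements of \<open>A\<close> that are related
  to elements outside. A valuation gives \<open>Inl x\<close> the value of a first-order variable as a singleton,
  or \<open>{}\<close> if that value lies outside \<open>A\<close>, and \<open>Inr X\<close> the trace on \<open>A\<close> of a set variable.\<close>

type_synonym 'u marked = "('u \<Rightarrow> 'u \<Rightarrow> bool) \<times> 'u set \<times> 'u set"

type_synonym 'u valuation = "nat + nat \<Rightarrow> 'u set"

text \<open>The diagonal of the first component tells which sets are non-empty. The marks record
  contact with the outside, and the last component makes a singleton be answered by a
  singleton.\<close>

definition atoms :: "(nat + nat) set \<Rightarrow> 'u marked \<Rightarrow> 'u valuation \<Rightarrow>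
    (nat + nat) rel \<times> (nat + nat) rel \<times> (nat + nat) set \<times> (nat + nat) set" where
  "atoms I = (\<lambda>(R, A, M) h.
     ({(i, j). i \<in> I \<and> j \<in> I \<and> h i \<inter> h j \<noteq> {}},
      {(i, j). i \<in> I \<and> j \<in> I \<and> (\<exists>a\<in>h i. \<exists>b\<in>h j. R a b)},
      {i \<in> I. h i \<inter> M \<noteq> {}},
      {i \<in> I. is_singleton (h i)}))"

text \<open>A game with set moves only: a point move is the choice of a singleton, and the empty set
  stands for a point chosen elsewhere. Moves are confined to \<open>I\<close> to keep the number of
  classes finite.\<close>

fun ef_equiv :: "(nat + nat) set \<Rightarrow> nat \<Rightarrow> 'u marked \<times> 'u valuation \<Rightarrow> 'u marked \<times> 'u valuation \<Rightarrow> bool" where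
  "ef_equiv I 0 (S, h) (S', h') \<longleftrightarrow> atoms I S h = atoms I S' h'"
| "ef_equiv I (Suc m) (S, h) (S', h') \<longleftrightarrow> atoms I S h = atoms I S' h' \<and>
     (\<forall>i\<in>I. (\<forall>P\<subseteq>fst (snd S). \<exists>P'\<subseteq>fst (snd S'). ef_equiv I m (S, h(i := P)) (S', h'(i := P'))) \<and>
            (\<forall>P'\<subseteq>fst (snd S'). \<exists>P\<subseteq>fst (snd S). ef_equiv I m (S, h(i := P)) (S', h'(i := P'))))"

lemma ef_equiv_sym: "ef_equiv I m x y \<Longrightarrow> ef_equiv I m y x"
proof (induction m arbitrary: x y)
  case 0
  then show ?case by (cases x; cases y) auto
next
  case (Suc m)
  obtain S h S' h' where "x = (S, h)" "y = (S', h')" by (metis surj_pair)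
  with Suc show ?case by simp (meson)
qed

lemma ef_equiv_atoms: "ef_equiv I m (S, h) (S', h') \<Longrightarrow> atoms I S h = atoms I S' h'"
  by (cases m) auto

text \<open>Recoding by naturals keeps one type of colours for all ranks, as the induction on
  \<open>m\<close> requires.\<close>

lemma finite_range_to_nat:
  assumes "finite (range c)"
  shows "\<exists>c' :: _ \<Rightarrow> nat. finite (range c') \<and> (\<forall>x y. c' x = c' y \<longleftrightarrow> c x = c y)"
proof -
  obtain e :: "_ \<Rightarrow> nat" where "inj_on e (range c)"
    using finite_imp_inj_to_nat_seg[OF assms] by blast
  then show ?thesis
    using finite_imageI[OF assms, of e]
    by (intro exI[of _ "e \<circ> c"]) (auto simp: inj_on_eq_iff image_comp)
qed

lemma finite_range_atoms:
  assumes "finite I" shows "finite (range (\<lambda>(S, h). atoms I S h))"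
proof (rule finite_subset)
  show "range (\<lambda>(S, h). atoms I S h) \<subseteq> Pow (I \<times> I) \<times> Pow (I \<times> I) \<times> Pow I \<times> Pow I"
    by (auto simp: atoms_def)
qed (use assms in simp)

text \<open>The class at rank \<open>Suc m\<close> is determined by the atoms and by the set of
  rank-\<open>m\<close> colours that each variable's moves can reach, hence by one of finitely many
  data. Nothing depends on the size of the structure.\<close>

lemma ef_equiv_finite_index:
  assumes "finite I"
  shows "\<exists>c :: 'u marked \<times> 'u valuation \<Rightarrow> nat. finite (range c) \<and> (\<forall>x y. c x = c y \<longrightarrow> ef_equiv I m x y)"
proof (induction m)
  case 0
  obtain c :: "'u marked \<times> 'u valuation \<Rightarrow> nat" where "finite (range c)"
    "\<forall>x y. c x = c y \<longleftrightarrow> (\<lambda>(S, h). atoms I S h) x = (\<lambda>(S, h). atoms I S h) y"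
    using finite_range_to_nat[OF finite_range_atoms[OF assms]] by blast
  then show ?case by (intro exI[of _ c]) auto
next
  case (Suc m)
  then obtain c :: "'u marked \<times> 'u valuation \<Rightarrow> nat"
    where c: "finite (range c)" "\<And>x y. c x = c y \<Longrightarrow> ef_equiv I m x y" by blast
  define t where "t = (\<lambda>(S :: 'u marked, h :: 'u valuation).
    (atoms I S h, {(i, c (S, h(i := P))) | i P. i \<in> I \<and> P \<subseteq> fst (snd S)}))"
  let ?at = "\<lambda>(S :: 'u marked, h :: 'u valuation). atoms I S h"
  have "t (S, h) \<in> range ?at \<times> Pow (I \<times> range c)" for S h
    using rangeI[of ?at "(S, h)"] by (auto simp: t_def simp del: rangeI)
  then have "range t \<subseteq> range ?at \<times> Pow (I \<times> range c)" by (metis image_subsetI surj_pair)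
  then have "finite (range t)"
    by (rule finite_subset) (intro finite_cartesian_product finite_range_atoms[OF assms] c(1) assms finite_Pow_iff[THEN iffD2])
  then obtain c' :: "'u marked \<times> 'u valuation \<Rightarrow> nat"
    where c': "finite (range c')" "\<forall>x y. c' x = c' y \<longleftrightarrow> t x = t y"
    using finite_range_to_nat[of t] by blast
  have step: "\<exists>P'\<subseteq>fst (snd S'). ef_equiv I m (S, h(i := P)) (S', h'(i := P'))"
    if "t (S, h) = t (S', h')" "i \<in> I" "P \<subseteq> fst (snd S)" for S h S' h' i P
  proof -
    have "(i, c (S, h(i := P))) \<in> snd (t (S, h))" using that(2,3) by (auto simp: t_def)
    then have "(i, c (S, h(i := P))) \<in> snd (t (S', h'))" using that(1) by simp
    then obtain P' where "P' \<subseteq> fst (snd S')" "c (S, h(i := P)) = c (S', h'(i := P'))"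
      by (auto simp: t_def)
    then show ?thesis using c(2) by blast
  qed
  have "ef_equiv I (Suc m) (S, h) (S', h')" if "t (S, h) = t (S', h')" for S h S' h'
  proof -
    have "atoms I S h = atoms I S' h'" using that by (simp add: t_def)
    moreover have "\<exists>P\<subseteq>fst (snd S). ef_equiv I m (S, h(i := P)) (S', h'(i := P'))"
      if "i \<in> I" "P' \<subseteq> fst (snd S')" for i P'
      using step[OF \<open>t (S, h) = t (S', h')\<close>[symmetric] that] ef_equiv_sym by blast
    ultimately show ?thesis using step[OF that] by simp
  qed
  then have "ef_equiv I (Suc m) x y" if "c' x = c' y" for x y
  proof -
    obtain S h S' h' where xy: "x = (S, h)" "y = (S', h')" by (metis surj_pair)
    have "t x = t y" using c'(2) that by blast
    then show ?thesis using \<open>\<And>S h S' h'. t (S, h) = t (S', h') \<Longrightarrow> ef_equiv I (Suc m) (S, h) (S', h')\<close>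
      unfolding xy by blast
  qed
  then show ?case using c'(1) by blast
qed

definition restr :: "(nat \<Rightarrow> 'u) \<Rightarrow> (nat \<Rightarrow> 'u set) \<Rightarrow> 'u set \<Rightarrow> 'u valuation" where
  "restr f g A = case_sum (\<lambda>x. {f x} \<inter> A) (\<lambda>X. g X \<inter> A)"

lemma restr_simps [simp]: "restr f g A (Inl x) = {f x} \<inter> A" "restr f g A (Inr X) = g X \<inter> A"
  by (simp_all add: restr_def)

lemma restr_upd [simp]:
  "restr (f(x := a)) g A = (restr f g A)(Inl x := {a} \<inter> A)"
  "restr f (g(X := P)) A = (restr f g A)(Inr X := P \<inter> A)"
  by (auto simp: restr_def fun_eq_iff split: sum.splits)

fun qdepth :: "mso \<Rightarrow> nat" where
  "qdepth (Neg \<phi>) = qdepth \<phi>"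
| "qdepth (Conj \<phi> \<psi>) = max (qdepth \<phi>) (qdepth \<psi>)"
| "qdepth (ExFO x \<phi>) = Suc (qdepth \<phi>)"
| "qdepth (ExSO X \<phi>) = Suc (qdepth \<phi>)"
| "qdepth _ = 0"

text \<open>Bound variables are included, since the game has to allow moves at them.\<close>

fun vars :: "mso \<Rightarrow> (nat + nat) set" where
  "vars (Rel x y) = {Inl x, Inl y}"
| "vars (Eq x y) = {Inl x, Inl y}"
| "vars (Mem x X) = {Inl x, Inr X}"
| "vars (Neg \<phi>) = vars \<phi>"
| "vars (Conj \<phi> \<psi>) = vars \<phi> \<union> vars \<psi>"
| "vars (ExFO x \<phi>) = insert (Inl x) (vars \<phi>)"
| "vars (ExSO X \<phi>) = insert (Inr X) (vars \<phi>)"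

lemma finite_vars: "finite (vars \<phi>)"
  by (induction \<phi>) auto

text \<open>The last two equivalences are read off the atoms of the new position, at
  \<open>(i, i)\<close> and at \<open>i\<close>.\<close>

lemma ef_equiv_step:
  assumes "ef_equiv I (Suc m) ((R, A, M), h) ((R', A', M'), h')" "i \<in> I" "P \<subseteq> A"
  obtains P' where "P' \<subseteq> A'" "ef_equiv I m ((R, A, M), h(i := P)) ((R', A', M'), h'(i := P'))"
    "P' = {} \<longleftrightarrow> P = {}" "is_singleton P' \<longleftrightarrow> is_singleton P"
proof -
  obtain P' where P': "P' \<subseteq> A'" "ef_equiv I m ((R, A, M), h(i := P)) ((R', A', M'), h'(i := P'))"
    using assms by simp blast
  have at: "atoms I (R, A, M) (h(i := P)) = atoms I (R', A', M') (h'(i := P'))"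
    using ef_equiv_atoms[OF P'(2)] .
  then have "(i, i) \<in> fst (atoms I (R, A, M) (h(i := P))) \<longleftrightarrow> (i, i) \<in> fst (atoms I (R', A', M') (h'(i := P')))"
    "i \<in> snd (snd (snd (atoms I (R, A, M) (h(i := P))))) \<longleftrightarrow> i \<in> snd (snd (snd (atoms I (R', A', M') (h'(i := P')))))"
    by simp_all
  then show thesis using that P' assms(2) by (auto simp: atoms_def)
qed

text \<open>The move seen by a part when a first-order value is chosen outside it.\<close>

lemma ef_equiv_step_empty:
  assumes "ef_equiv I (Suc m) ((R, A, M), h) ((R', A', M'), h')" "i \<in> I"
  shows "ef_equiv I m ((R, A, M), h(i := {})) ((R', A', M'), h'(i := {}))"
  using ef_equiv_step[OF assms, of "{}"] by (metis empty_subsetI)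

lemma ef_equiv_step_point:
  assumes "ef_equiv I (Suc m) ((R, A, M), h) ((R', A', M'), h')" "i \<in> I" "a \<in> A"
  obtains a' where "a' \<in> A'" "ef_equiv I m ((R, A, M), h(i := {a})) ((R', A', M'), h'(i := {a'}))"
proof -
  have "{a} \<subseteq> A" using assms(3) by simp
  then obtain P' where P': "P' \<subseteq> A'" "is_singleton P' \<longleftrightarrow> is_singleton {a}"
    "ef_equiv I m ((R, A, M), h(i := {a})) ((R', A', M'), h'(i := P'))"
    by (rule ef_equiv_step[OF assms(1,2)])
  then obtain a' where "P' = {a'}" by (auto simp del: ef_equiv.simps elim: is_singletonE)
  with P' show thesis using that by blast
qed

declare ef_equiv.simps [simp del]

section \<open>The game on two interchanged branches\<close>

text \<open>From outside, a branch shows only its marked elements: these point to exactly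
  \<open>N\<close> and are pointed to by exactly \<open>N'\<close>. As both sets avoid the branches,
  no element of one branch is related to one of the other.\<close>

locale two_branches =
  fixes U A\<^sub>1 A\<^sub>2 M\<^sub>1 M\<^sub>2 N N' :: "'u set" and R :: "'u \<Rightarrow> 'u \<Rightarrow> bool"
  assumes sub: "A\<^sub>1 \<subseteq> U" "A\<^sub>2 \<subseteq> U" and disj: "A\<^sub>1 \<inter> A\<^sub>2 = {}"
    and N: "N \<inter> (A\<^sub>1 \<union> A\<^sub>2) = {}" "N' \<inter> (A\<^sub>1 \<union> A\<^sub>2) = {}"
    and cross\<^sub>1: "\<And>x y. x \<in> A\<^sub>1 \<Longrightarrow> y \<in> U - A\<^sub>1 \<Longrightarrow> (R x y \<longleftrightarrow> x \<in> M\<^sub>1 \<and> y \<in> N) \<and> (R y x \<longleftrightarrow> x \<in> M\<^sub>1 \<and> y \<in> N')"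
    and cross\<^sub>2: "\<And>x y. x \<in> A\<^sub>2 \<Longrightarrow> y \<in> U - A\<^sub>2 \<Longrightarrow> (R x y \<longleftrightarrow> x \<in> M\<^sub>2 \<and> y \<in> N) \<and> (R y x \<longleftrightarrow> x \<in> M\<^sub>2 \<and> y \<in> N')"
begin

text \<open>The primed valuation looks like the other one with the branches exchanged, inside the
  same structure. Outside them, both agree literally. Every clause is symmetric under exchanging the
  two valuations.\<close>

definition swap_inv :: "(nat + nat) set \<Rightarrow> nat \<Rightarrow> (nat \<Rightarrow> 'u) \<Rightarrow> (nat \<Rightarrow> 'u set) \<Rightarrow>
    (nat \<Rightarrow> 'u) \<Rightarrow> (nat \<Rightarrow> 'u set) \<Rightarrow> bool" where
  "swap_inv I m f g f' g' \<longleftrightarrow>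
     (\<forall>x. f x \<in> U \<and> f' x \<in> U) \<and>
     (\<forall>x. Inl x \<in> I \<longrightarrow> f x \<notin> A\<^sub>1 \<union> A\<^sub>2 \<or> f' x \<notin> A\<^sub>1 \<union> A\<^sub>2 \<longrightarrow> f x = f' x) \<and>
     (\<forall>X. Inr X \<in> I \<longrightarrow> g X - (A\<^sub>1 \<union> A\<^sub>2) = g' X - (A\<^sub>1 \<union> A\<^sub>2)) \<and>
     ef_equiv I m ((R, A\<^sub>1, M\<^sub>1), restr f g A\<^sub>1) ((R, A\<^sub>2, M\<^sub>2), restr f' g' A\<^sub>2) \<and>
     ef_equiv I m ((R, A\<^sub>2, M\<^sub>2), restr f g A\<^sub>2) ((R, A\<^sub>1, M\<^sub>1), restr f' g' A\<^sub>1)"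

lemma swap_inv_sym: "swap_inv I m f g f' g' \<Longrightarrow> swap_inv I m f' g' f g"
  unfolding swap_inv_def by (elim conjE, intro conjI) (metis | erule ef_equiv_sym)+

lemma swap_invD:
  assumes "swap_inv I m f g f' g'"
  shows "f x \<in> U" "f' x \<in> U"
    and "Inl x \<in> I \<Longrightarrow> f x \<notin> A\<^sub>1 \<union> A\<^sub>2 \<Longrightarrow> f x = f' x"
    and "Inr X \<in> I \<Longrightarrow> g X - (A\<^sub>1 \<union> A\<^sub>2) = g' X - (A\<^sub>1 \<union> A\<^sub>2)"
    and "Inl x \<in> I \<Longrightarrow> f x \<notin> A\<^sub>1 \<union> A\<^sub>2 \<or> f' x \<notin> A\<^sub>1 \<union> A\<^sub>2 \<Longrightarrow> f x = f' x"
  using assms unfolding swap_inv_def by blast+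

lemma swap_inv_atoms:
  assumes "swap_inv I m f g f' g'"
  shows "atoms I (R, A\<^sub>1, M\<^sub>1) (restr f g A\<^sub>1) = atoms I (R, A\<^sub>2, M\<^sub>2) (restr f' g' A\<^sub>2)"
    and "atoms I (R, A\<^sub>2, M\<^sub>2) (restr f g A\<^sub>2) = atoms I (R, A\<^sub>1, M\<^sub>1) (restr f' g' A\<^sub>1)"
  using assms ef_equiv_atoms unfolding swap_inv_def by blast+

text \<open>A point lies in a part iff its trace there is non-empty, and in the marked set iff the
  trace meets it; both are atoms.\<close>

lemma swap_inv_part:
  assumes inv: "swap_inv I m f g f' g'" and x: "Inl x \<in> I"
  shows "f x \<in> A\<^sub>1 \<longleftrightarrow> f' x \<in> A\<^sub>2" "f x \<in> A\<^sub>2 \<longleftrightarrow> f' x \<in> A\<^sub>1"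
    "f x \<in> M\<^sub>1 \<inter> A\<^sub>1 \<longleftrightarrow> f' x \<in> M\<^sub>2 \<inter> A\<^sub>2" "f x \<in> M\<^sub>2 \<inter> A\<^sub>2 \<longleftrightarrow> f' x \<in> M\<^sub>1 \<inter> A\<^sub>1"
proof -
  note at = swap_inv_atoms[OF inv, unfolded atoms_def, simplified]
  have "(Inl x, Inl x) \<in> {(i, j). i \<in> I \<and> j \<in> I \<and> restr f g A\<^sub>1 i \<inter> restr f g A\<^sub>1 j \<noteq> {}} \<longleftrightarrow>
     (Inl x, Inl x) \<in> {(i, j). i \<in> I \<and> j \<in> I \<and> restr f' g' A\<^sub>2 i \<inter> restr f' g' A\<^sub>2 j \<noteq> {}}"
    "(Inl x, Inl x) \<in> {(i, j). i \<in> I \<and> j \<in> I \<and> restr f g A\<^sub>2 i \<inter> restr f g A\<^sub>2 j \<noteq> {}} \<longleftrightarrow>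
     (Inl x, Inl x) \<in> {(i, j). i \<in> I \<and> j \<in> I \<and> restr f' g' A\<^sub>1 i \<inter> restr f' g' A\<^sub>1 j \<noteq> {}}"
    "Inl x \<in> {i \<in> I. restr f g A\<^sub>1 i \<inter> M\<^sub>1 \<noteq> {}} \<longleftrightarrow> Inl x \<in> {i \<in> I. restr f' g' A\<^sub>2 i \<inter> M\<^sub>2 \<noteq> {}}"
    "Inl x \<in> {i \<in> I. restr f g A\<^sub>2 i \<inter> M\<^sub>2 \<noteq> {}} \<longleftrightarrow> Inl x \<in> {i \<in> I. restr f' g' A\<^sub>1 i \<inter> M\<^sub>1 \<noteq> {}}"
    using at by simp_all
  then show "f x \<in> A\<^sub>1 \<longleftrightarrow> f' x \<in> A\<^sub>2" "f x \<in> A\<^sub>2 \<longleftrightarrow> f' x \<in> A\<^sub>1"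
    "f x \<in> M\<^sub>1 \<inter> A\<^sub>1 \<longleftrightarrow> f' x \<in> M\<^sub>2 \<inter> A\<^sub>2" "f x \<in> M\<^sub>2 \<inter> A\<^sub>2 \<longleftrightarrow> f' x \<in> M\<^sub>1 \<inter> A\<^sub>1"
    using x by auto
qed

text \<open>Taking \<open>Inl y\<close> for \<open>j\<close> yields equality of values, taking
  \<open>Inr X\<close> membership.\<close>

lemma swap_inv_overlap:
  assumes inv: "swap_inv I m f g f' g'" and x: "Inl x \<in> I" and j: "j \<in> I"
  shows "f x \<in> A\<^sub>1 \<Longrightarrow> f x \<in> restr f g A\<^sub>1 j \<longleftrightarrow> f' x \<in> restr f' g' A\<^sub>2 j"
    "f x \<in> A\<^sub>2 \<Longrightarrow> f x \<in> restr f g A\<^sub>2 j \<longleftrightarrow> f' x \<in> restr f' g' A\<^sub>1 j"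
proof -
  note at = swap_inv_atoms[OF inv, unfolded atoms_def, simplified]
  have "(Inl x, j) \<in> {(i, j). i \<in> I \<and> j \<in> I \<and> restr f g A\<^sub>1 i \<inter> restr f g A\<^sub>1 j \<noteq> {}} \<longleftrightarrow>
     (Inl x, j) \<in> {(i, j). i \<in> I \<and> j \<in> I \<and> restr f' g' A\<^sub>2 i \<inter> restr f' g' A\<^sub>2 j \<noteq> {}}"
    "(Inl x, j) \<in> {(i, j). i \<in> I \<and> j \<in> I \<and> restr f g A\<^sub>2 i \<inter> restr f g A\<^sub>2 j \<noteq> {}} \<longleftrightarrow>
     (Inl x, j) \<in> {(i, j). i \<in> I \<and> j \<in> I \<and> restr f' g' A\<^sub>1 i \<inter> restr f' g' A\<^sub>1 j \<noteq> {}}"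
    using at by simp_all
  then show "f x \<in> A\<^sub>1 \<Longrightarrow> f x \<in> restr f g A\<^sub>1 j \<longleftrightarrow> f' x \<in> restr f' g' A\<^sub>2 j"
    "f x \<in> A\<^sub>2 \<Longrightarrow> f x \<in> restr f g A\<^sub>2 j \<longleftrightarrow> f' x \<in> restr f' g' A\<^sub>1 j"
    using x j swap_inv_part(1,2)[OF inv x] by auto
qed

lemma swap_inv_inner:
  assumes inv: "swap_inv I m f g f' g'" and I: "Inl x \<in> I" "Inl y \<in> I"
  shows "f x \<in> A\<^sub>1 \<Longrightarrow> f y \<in> A\<^sub>1 \<Longrightarrow> R (f x) (f y) \<longleftrightarrow> R (f' x) (f' y)"
    "f x \<in> A\<^sub>2 \<Longrightarrow> f y \<in> A\<^sub>2 \<Longrightarrow> R (f x) (f y) \<longleftrightarrow> R (f' x) (f' y)"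
proof -
  note at = swap_inv_atoms[OF inv, unfolded atoms_def, simplified]
  have "(Inl x, Inl y) \<in> {(i, j). i \<in> I \<and> j \<in> I \<and> (\<exists>a\<in>restr f g A\<^sub>1 i. \<exists>b\<in>restr f g A\<^sub>1 j. R a b)} \<longleftrightarrow>
     (Inl x, Inl y) \<in> {(i, j). i \<in> I \<and> j \<in> I \<and> (\<exists>a\<in>restr f' g' A\<^sub>2 i. \<exists>b\<in>restr f' g' A\<^sub>2 j. R a b)}"
    "(Inl x, Inl y) \<in> {(i, j). i \<in> I \<and> j \<in> I \<and> (\<exists>a\<in>restr f g A\<^sub>2 i. \<exists>b\<in>restr f g A\<^sub>2 j. R a b)} \<longleftrightarrow>
     (Inl x, Inl y) \<in> {(i, j). i \<in> I \<and> j \<in> I \<and> (\<exists>a\<in>restr f' g' A\<^sub>1 i. \<exists>b\<in>restr f' g' A\<^sub>1 j. R a b)}"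
    using at by simp_all
  then show "f x \<in> A\<^sub>1 \<Longrightarrow> f y \<in> A\<^sub>1 \<Longrightarrow> R (f x) (f y) \<longleftrightarrow> R (f' x) (f' y)"
    "f x \<in> A\<^sub>2 \<Longrightarrow> f y \<in> A\<^sub>2 \<Longrightarrow> R (f x) (f y) \<longleftrightarrow> R (f' x) (f' y)"
    using I swap_inv_part(1,2)[OF inv I(1)] swap_inv_part(1,2)[OF inv I(2)] by auto
qed

lemma swap_inv_Rel:
  assumes inv: "swap_inv I m f g f' g'" and I: "Inl x \<in> I" "Inl y \<in> I"
  shows "R (f x) (f y) \<longleftrightarrow> R (f' x) (f' y)"
proof -
  note px = swap_inv_part[OF inv I(1)] and py = swap_inv_part[OF inv I(2)]
  note U = swap_invD(1,2)[OF inv, of x] swap_invD(1,2)[OF inv, of y]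
  note fix1 = swap_invD(3)[OF inv I(1)] swap_invD(3)[OF inv I(2)]
  consider "f x \<in> A\<^sub>1" "f y \<in> A\<^sub>1" | "f x \<in> A\<^sub>2" "f y \<in> A\<^sub>2" | "f x \<in> A\<^sub>1" "f y \<in> A\<^sub>2" | "f x \<in> A\<^sub>2" "f y \<in> A\<^sub>1"
    | "f x \<in> A\<^sub>1" "f y \<notin> A\<^sub>1 \<union> A\<^sub>2" | "f x \<in> A\<^sub>2" "f y \<notin> A\<^sub>1 \<union> A\<^sub>2"
    | "f x \<notin> A\<^sub>1 \<union> A\<^sub>2" "f y \<in> A\<^sub>1" | "f x \<notin> A\<^sub>1 \<union> A\<^sub>2" "f y \<in> A\<^sub>2"
    | "f x \<notin> A\<^sub>1 \<union> A\<^sub>2" "f y \<notin> A\<^sub>1 \<union> A\<^sub>2" by blast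
  then show ?thesis
  proof cases
    case 1 then show ?thesis using swap_inv_inner[OF inv I] by blast
  next
    case 2 then show ?thesis using swap_inv_inner[OF inv I] by blast
  next
    \<comment> \<open>Both sides are false here, as distinct branches are unrelated.\<close>
    case 3 then show ?thesis using cross\<^sub>1[of "f x" "f y"] cross\<^sub>2[of "f' x" "f' y"] U N disj px py by blast
  next
    case 4 then show ?thesis using cross\<^sub>2[of "f x" "f y"] cross\<^sub>1[of "f' x" "f' y"] U N disj px py by blast
  next
    \<comment> \<open>The outer point stays fixed, and the inner one keeps its mark while changing
      branch.\<close>
    case 5 then show ?thesis using cross\<^sub>1[of "f x" "f y"] cross\<^sub>2[of "f' x" "f' y"] U px py fix1(2)[OF 5(2)] by auto
  next
    case 6 then show ?thesis using cross\<^sub>2[of "f x" "f y"] cross\<^sub>1[of "f' x" "f' y"] U px py fix1(2)[OF 6(2)] by auto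
  next
    case 7 then show ?thesis using cross\<^sub>1[of "f y" "f x"] cross\<^sub>2[of "f' y" "f' x"] U px py fix1(1)[OF 7(1)] by auto
  next
    case 8 then show ?thesis using cross\<^sub>2[of "f y" "f x"] cross\<^sub>1[of "f' y" "f' x"] U px py fix1(1)[OF 8(1)] by auto
  next
    case 9 then show ?thesis using fix1 by simp
  qed
qed

lemma swap_inv_Eq:
  assumes inv: "swap_inv I m f g f' g'" and I: "Inl x \<in> I" "Inl y \<in> I"
  shows "f x = f y \<longleftrightarrow> f' x = f' y"
proof -
  note px = swap_inv_part[OF inv I(1)] and py = swap_inv_part[OF inv I(2)]
  note fix1 = swap_invD(3)[OF inv I(1)] swap_invD(3)[OF inv I(2)]
  consider "f x \<in> A\<^sub>1" | "f x \<in> A\<^sub>2" | "f x \<notin> A\<^sub>1 \<union> A\<^sub>2" by blast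
  then show ?thesis
  proof cases
    case 1 then show ?thesis using swap_inv_overlap(1)[OF inv I] px py by auto
  next
    case 2 then show ?thesis using swap_inv_overlap(2)[OF inv I] px py by auto
  next
    case 3 then show ?thesis using fix1 px py by (metis Un_iff)
  qed
qed

lemma swap_inv_Mem:
  assumes inv: "swap_inv I m f g f' g'" and I: "Inl x \<in> I" "Inr X \<in> I"
  shows "f x \<in> g X \<longleftrightarrow> f' x \<in> g' X"
proof -
  note px = swap_inv_part[OF inv I(1)]
  consider "f x \<in> A\<^sub>1" | "f x \<in> A\<^sub>2" | "f x \<notin> A\<^sub>1 \<union> A\<^sub>2" by blast
  then show ?thesis
  proof cases
    case 1 then show ?thesis using swap_inv_overlap(1)[OF inv I] px by auto
  next
    case 2 then show ?thesis using swap_inv_overlap(2)[OF inv I] px by auto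
  next
    case 3
    then have "f x = f' x" using swap_invD(3)[OF inv I(1)] by blast
    then show ?thesis using 3 swap_invD(4)[OF inv I(2)] by (metis Diff_iff)
  qed
qed

text \<open>A point of one branch is answered in the other by the strategy, while the second game
  sees the empty set on both sides; a point outside answers itself.\<close>

lemma swap_inv_FO_step:
  assumes inv: "swap_inv I (Suc m) f g f' g'" and x: "Inl x \<in> I" and a: "a \<in> U"
  shows "\<exists>a'\<in>U. swap_inv I m (f(x := a)) g (f'(x := a')) g'"
proof -
  have e1: "ef_equiv I (Suc m) ((R, A\<^sub>1, M\<^sub>1), restr f g A\<^sub>1) ((R, A\<^sub>2, M\<^sub>2), restr f' g' A\<^sub>2)"
    and e2: "ef_equiv I (Suc m) ((R, A\<^sub>2, M\<^sub>2), restr f g A\<^sub>2) ((R, A\<^sub>1, M\<^sub>1), restr f' g' A\<^sub>1)"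
    using inv unfolding swap_inv_def by auto
  note z1 = ef_equiv_step_empty[OF e1 x] and z2 = ef_equiv_step_empty[OF e2 x]
  have upd: "swap_inv I m (f(x := a)) g (f'(x := a')) g'"
    if "a' \<in> U" "a \<notin> A\<^sub>1 \<union> A\<^sub>2 \<or> a' \<notin> A\<^sub>1 \<union> A\<^sub>2 \<longrightarrow> a = a'"
      "ef_equiv I m ((R, A\<^sub>1, M\<^sub>1), (restr f g A\<^sub>1)(Inl x := {a} \<inter> A\<^sub>1)) ((R, A\<^sub>2, M\<^sub>2), (restr f' g' A\<^sub>2)(Inl x := {a'} \<inter> A\<^sub>2))"
      "ef_equiv I m ((R, A\<^sub>2, M\<^sub>2), (restr f g A\<^sub>2)(Inl x := {a} \<inter> A\<^sub>2)) ((R, A\<^sub>1, M\<^sub>1), (restr f' g' A\<^sub>1)(Inl x := {a'} \<inter> A\<^sub>1))"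
    for a'
    unfolding swap_inv_def restr_upd
  proof (intro conjI allI impI)
    fix z
    show "(f(x := a)) z \<in> U" "(f'(x := a')) z \<in> U" using swap_invD(1,2)[OF inv, of z] a that(1) by simp_all
    assume z: "Inl z \<in> I" "(f(x := a)) z \<notin> A\<^sub>1 \<union> A\<^sub>2 \<or> (f'(x := a')) z \<notin> A\<^sub>1 \<union> A\<^sub>2"
    show "(f(x := a)) z = (f'(x := a')) z"
    proof (cases "z = x")
      case True
      then have "(f(x := a)) z = a" "(f'(x := a')) z = a'" by simp_all
      then show ?thesis using that(2) z(2) by metis
    next
      case False
      then have "f z \<notin> A\<^sub>1 \<union> A\<^sub>2 \<or> f' z \<notin> A\<^sub>1 \<union> A\<^sub>2" using z(2) by simp
      from swap_invD(5)[OF inv z(1) this] show ?thesis using False by simp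
    qed
  qed (use that(3,4) swap_invD(4)[OF inv] in blast)+
  consider "a \<in> A\<^sub>1" | "a \<in> A\<^sub>2" | "a \<notin> A\<^sub>1 \<union> A\<^sub>2" by blast
  then show ?thesis
  proof cases
    case 1
    obtain a' where a': "a' \<in> A\<^sub>2"
      "ef_equiv I m ((R, A\<^sub>1, M\<^sub>1), (restr f g A\<^sub>1)(Inl x := {a})) ((R, A\<^sub>2, M\<^sub>2), (restr f' g' A\<^sub>2)(Inl x := {a'}))"
      by (rule ef_equiv_step_point[OF e1 x 1])
    have *: "{a} \<inter> A\<^sub>1 = {a}" "{a} \<inter> A\<^sub>2 = {}" "{a'} \<inter> A\<^sub>2 = {a'}" "{a'} \<inter> A\<^sub>1 = {}"
      using 1 a' disj by auto
    have "a' \<in> U" using a' sub by blast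
    then show ?thesis
      using upd[of a', unfolded *, OF _ _ a'(2) z2] 1 a'(1) by blast
  next
    case 2
    obtain a' where a': "a' \<in> A\<^sub>1"
      "ef_equiv I m ((R, A\<^sub>2, M\<^sub>2), (restr f g A\<^sub>2)(Inl x := {a})) ((R, A\<^sub>1, M\<^sub>1), (restr f' g' A\<^sub>1)(Inl x := {a'}))"
      by (rule ef_equiv_step_point[OF e2 x 2])
    have *: "{a} \<inter> A\<^sub>2 = {a}" "{a} \<inter> A\<^sub>1 = {}" "{a'} \<inter> A\<^sub>1 = {a'}" "{a'} \<inter> A\<^sub>2 = {}"
      using 2 a' disj by auto
    have "a' \<in> U" using a' sub by blast
    then show ?thesis
      using upd[of a', unfolded *, OF _ _ z1 a'(2)] 2 a'(1) by blast
  next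
    case 3
    then have *: "{a} \<inter> A\<^sub>2 = {}" "{a} \<inter> A\<^sub>1 = {}" by auto
    show ?thesis using upd[of a, unfolded *, OF a _ z1 z2] a by blast
  qed
qed

lemma swap_inv_SO_step:
  assumes inv: "swap_inv I (Suc m) f g f' g'" and X: "Inr X \<in> I" and P: "P \<subseteq> U"
  shows "\<exists>P'\<subseteq>U. swap_inv I m f (g(X := P)) f' (g'(X := P'))"
proof -
  have e1: "ef_equiv I (Suc m) ((R, A\<^sub>1, M\<^sub>1), restr f g A\<^sub>1) ((R, A\<^sub>2, M\<^sub>2), restr f' g' A\<^sub>2)"
    and e2: "ef_equiv I (Suc m) ((R, A\<^sub>2, M\<^sub>2), restr f g A\<^sub>2) ((R, A\<^sub>1, M\<^sub>1), restr f' g' A\<^sub>1)"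
    using inv unfolding swap_inv_def by auto
  obtain P2 where P2: "P2 \<subseteq> A\<^sub>2"
    "ef_equiv I m ((R, A\<^sub>1, M\<^sub>1), (restr f g A\<^sub>1)(Inr X := P \<inter> A\<^sub>1)) ((R, A\<^sub>2, M\<^sub>2), (restr f' g' A\<^sub>2)(Inr X := P2))"
    using ef_equiv_step[OF e1 X, of "P \<inter> A\<^sub>1"] by blast
  obtain P1 where P1: "P1 \<subseteq> A\<^sub>1"
    "ef_equiv I m ((R, A\<^sub>2, M\<^sub>2), (restr f g A\<^sub>2)(Inr X := P \<inter> A\<^sub>2)) ((R, A\<^sub>1, M\<^sub>1), (restr f' g' A\<^sub>1)(Inr X := P1))"
    using ef_equiv_step[OF e2 X, of "P \<inter> A\<^sub>2"] by blast
  \<comment> \<open>The part of \<open>P\<close> outside is copied; \<open>P2\<close> answers the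
    trace on \<open>A\<^sub>1\<close> and \<open>P1\<close> the trace on
    \<open>A\<^sub>2\<close>.\<close>
  let ?P = "(P - (A\<^sub>1 \<union> A\<^sub>2)) \<union> P1 \<union> P2"
  have *: "?P \<inter> A\<^sub>1 = P1" "?P \<inter> A\<^sub>2 = P2" "?P - (A\<^sub>1 \<union> A\<^sub>2) = P - (A\<^sub>1 \<union> A\<^sub>2)" using P1 P2 disj by auto
  have "?P \<subseteq> U" using P P1 P2 sub by auto
  moreover have "swap_inv I m f (g(X := P)) f' (g'(X := ?P))"
    unfolding swap_inv_def restr_upd *
  proof (intro conjI allI impI)
    fix Y assume "Inr Y \<in> I"
    then show "(g(X := P)) Y - (A\<^sub>1 \<union> A\<^sub>2) = (g'(X := ?P)) Y - (A\<^sub>1 \<union> A\<^sub>2)"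
      using swap_invD(4)[OF inv, of Y] * by (cases "Y = X") simp_all
  qed (use P1 P2 swap_invD(1,2,5)[OF inv] in blast)+
  ultimately show ?thesis by blast
qed

text \<open>Each quantifier uses up one round. Witnesses are carried over in one direction, and the
  symmetry of \<open>swap_inv\<close> gives the other.\<close>

lemma swap_inv_sat:
  "\<lbrakk>vars \<phi> \<subseteq> I; qdepth \<phi> \<le> m; swap_inv I m f g f' g'\<rbrakk> \<Longrightarrow> sat (U, R) f g \<phi> \<longleftrightarrow> sat (U, R) f' g' \<phi>"
proof (induction \<phi> arbitrary: m f g f' g')
  case (Rel x y)
  then show ?case using swap_inv_Rel[OF Rel(3), of x y] by simp
next
  case (Eq x y)
  then show ?case using swap_inv_Eq[OF Eq(3), of x y] by simp
next
  case (Mem x X)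
  then show ?case using swap_inv_Mem[OF Mem(3), of x X] by simp
next
  case (Neg \<phi>)
  have "vars \<phi> \<subseteq> I" "qdepth \<phi> \<le> m" using Neg.prems by simp_all
  from Neg.IH[OF this Neg.prems(3)] show ?case by simp
next
  case (Conj \<phi> \<psi>)
  have "vars \<phi> \<subseteq> I" "qdepth \<phi> \<le> m" "vars \<psi> \<subseteq> I" "qdepth \<psi> \<le> m" using Conj.prems by simp_all
  then show ?case
    using Conj.IH(1)[OF _ _ Conj.prems(3)] Conj.IH(2)[OF _ _ Conj.prems(3)] by simp
next
  case (ExFO x \<phi>)
  then obtain k where k: "m = Suc k" "qdepth \<phi> \<le> k" by (cases m) auto
  have x: "Inl x \<in> I" and v: "vars \<phi> \<subseteq> I" using ExFO.prems(1) by simp_all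
  have "\<exists>a'\<in>U. sat (U, R) (f2(x := a')) g2 \<phi>"
    if st: "swap_inv I m f1 g1 f2 g2" "a \<in> U" "sat (U, R) (f1(x := a)) g1 \<phi>" for f1 g1 f2 g2 a
  proof -
    obtain a' where "a' \<in> U" "swap_inv I k (f1(x := a)) g1 (f2(x := a')) g2"
      using swap_inv_FO_step[OF st(1)[unfolded k(1)] x st(2)] by blast
    then show ?thesis using ExFO.IH[OF v k(2)] st(3) by blast
  qed
  from this[OF ExFO.prems(3)] this[OF swap_inv_sym[OF ExFO.prems(3)]] show ?case
    unfolding sat.simps fst_conv by blast
next
  case (ExSO X \<phi>)
  then obtain k where k: "m = Suc k" "qdepth \<phi> \<le> k" by (cases m) auto
  have X: "Inr X \<in> I" and v: "vars \<phi> \<subseteq> I" using ExSO.prems(1) by simp_all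
  have "\<exists>P'. P' \<subseteq> U \<and> sat (U, R) f2 (g2(X := P')) \<phi>"
    if st: "swap_inv I m f1 g1 f2 g2" "P \<subseteq> U" "sat (U, R) f1 (g1(X := P)) \<phi>" for f1 g1 f2 g2 P
  proof -
    obtain P' where "P' \<subseteq> U" "swap_inv I k f1 (g1(X := P)) f2 (g2(X := P'))"
      using swap_inv_SO_step[OF st(1)[unfolded k(1)] X st(2)] by blast
    then show ?thesis using ExSO.IH[OF v k(2)] st(3) by blast
  qed
  from this[OF ExSO.prems(3)] this[OF swap_inv_sym[OF ExSO.prems(3)]] show ?case
    unfolding sat.simps fst_conv by blast
qed

end

section \<open>Many branches and the pigeonhole bound\<close>

text \<open>Any two distinct members form an instance of \<open>two_branches\<close>, with outer
  sets common to the family.\<close>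

definition branching :: "'u mstruct \<Rightarrow> 'i set \<Rightarrow> ('i \<Rightarrow> 'u set) \<Rightarrow> ('i \<Rightarrow> 'u set) \<Rightarrow> 'u set \<Rightarrow> 'u set \<Rightarrow> bool" where
  "branching S J A M N N' \<longleftrightarrow>
     (\<forall>j\<in>J. A j \<noteq> {} \<and> A j \<subseteq> fst S \<and> A j \<inter> N = {} \<and> A j \<inter> N' = {}) \<and>
     (\<forall>i\<in>J. \<forall>j\<in>J. i \<noteq> j \<longrightarrow> A i \<inter> A j = {}) \<and>
     (\<forall>j\<in>J. \<forall>x\<in>A j. \<forall>y\<in>fst S - A j.
        (snd S x y \<longleftrightarrow> x \<in> M j \<and> y \<in> N) \<and> (snd S y x \<longleftrightarrow> x \<in> M j \<and> y \<in> N'))"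

text \<open>With more branches than pairs of types, two branches \<open>i\<close> and
  \<open>j\<close> agree in both views. Then \<open>\<phi>\<close> treats \<open>(a i, a j)\<close>
  and \<open>(a j, a i)\<close> alike, which antisymmetry and totality forbid.\<close>

lemma orderable_branching_bound:
  fixes C :: "'u mstruct set"
  assumes "MSO_orderable C"
  shows "\<exists>d. \<forall>S\<in>C. \<forall>(J :: 'i set) A M N N'. branching S J A M N N' \<longrightarrow> finite J \<longrightarrow> card J \<le> d"
proof -
  obtain \<phi> n where ord: "defines_order \<phi> n C" using assms by (auto simp: MSO_orderable_def)
  define I where "I = vars \<phi>"
  obtain c :: "'u marked \<times> 'u valuation \<Rightarrow> nat"
    where c: "finite (range c)" "\<And>x y. c x = c y \<Longrightarrow> ef_equiv I (qdepth \<phi>) x y"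
    using ef_equiv_finite_index[of I "qdepth \<phi>"] finite_vars[of \<phi>] unfolding I_def by blast
  have "card J \<le> card (range c \<times> range c)"
    if S: "S \<in> C" and br: "branching S J A M N N'" and J: "finite J" for S and J :: "'i set" and A M N N'
  proof (rule ccontr)
    obtain U R where UR: "S = (U, R)" by fastforce
    assume nle: "\<not> ?thesis"
    then have "J \<noteq> {}" by auto
    then have "U \<noteq> {}" using br UR unfolding branching_def by fastforce
    then obtain P where lin: "linear_order_on U
        {(a, b). a \<in> U \<and> b \<in> U \<and> sat S (\<lambda>i. if i = 0 then a else b) P \<phi>}"
      using ord S UR unfolding defines_order_def by fastforce
    have "\<forall>j\<in>J. \<exists>a. a \<in> A j" using br by (auto simp: branching_def)
    then obtain a where a: "\<And>j. j \<in> J \<Longrightarrow> a j \<in> A j" by metis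
    \<comment> \<open>In \<open>hx\<close> the branch holds the first value and the other lies
      elsewhere; \<open>hy\<close> reverses the roles. All indices other than 0 carry the second
      value, as in \<open>defines_order\<close>.\<close>
    define hx where "hx j = case_sum (\<lambda>k::nat. if k = 0 then {a j} else {}) (\<lambda>X. P X \<inter> A j)" for j
    define hy where "hy j = case_sum (\<lambda>k::nat. if k = 0 then {} else {a j}) (\<lambda>X. P X \<inter> A j)" for j
    define t where "t j = (c ((R, A j, M j), hx j), c ((R, A j, M j), hy j))" for j
    have "card (t ` J) \<le> card (range c \<times> range c)"
      by (rule card_mono) (use c in \<open>auto simp: t_def\<close>)
    then obtain i j where ij: "i \<in> J" "j \<in> J" "i \<noteq> j" "t i = t j"
      using nle pigeonhole[of t J] by (auto simp: inj_on_def)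
    interpret two_branches U "A i" "A j" "M i" "M j" N N' R
      by unfold_locales (use br ij UR in \<open>auto simp: branching_def\<close>)
    let ?f = "\<lambda>k::nat. if k = 0 then a i else a j" and ?f' = "\<lambda>k::nat. if k = 0 then a j else a i"
    have notin: "a i \<notin> A j" "a j \<notin> A i" and U: "a i \<in> U" "a j \<in> U"
      using a[OF ij(1)] a[OF ij(2)] disj sub by auto
    have "restr ?f P (A i) = hx i" "restr ?f' P (A j) = hx j" "restr ?f P (A j) = hy j" "restr ?f' P (A i) = hy i"
      using notin a ij by (auto simp: restr_def hx_def hy_def fun_eq_iff split: sum.splits)
    moreover have "ef_equiv I (qdepth \<phi>) ((R, A i, M i), hx i) ((R, A j, M j), hx j)"
      "ef_equiv I (qdepth \<phi>) ((R, A j, M j), hy j) ((R, A i, M i), hy i)"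
      using c(2) ij(4) unfolding t_def by auto
    ultimately have "swap_inv I (qdepth \<phi>) ?f P ?f' P"
      using U a ij unfolding swap_inv_def by auto
    from swap_inv_sat[OF _ _ this, of \<phi>] have "sat S ?f P \<phi> \<longleftrightarrow> sat S ?f' P \<phi>"
      by (simp add: I_def UR)
    moreover have "a i \<noteq> a j" using notin a ij by auto
    ultimately show False
      using lin U unfolding linear_order_on_def partial_order_on_def antisym_def total_on_def by blast
  qed
  then show ?thesis by blast
qed

section \<open>Branches of a tree at a vertex\<close>

lemma rtranclp_sym:
  assumes "r\<^sup>*\<^sup>* x y" and sym: "\<And>x y. r x y \<Longrightarrow> r y x"
  shows "r\<^sup>*\<^sup>* y x"
  using assms(1) by induction (auto intro: sym converse_rtranclp_into_rtranclp)

text \<open>If the next vertex already occurs, the path is cut at that occurrence. The last conjunct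
  later places the whole path inside a branch.\<close>

lemma rtranclp_distinct_path:
  assumes "r\<^sup>*\<^sup>* x y"
  shows "\<exists>vs. vs \<noteq> [] \<and> distinct vs \<and> hd vs = x \<and> last vs = y \<and> successively r vs \<and> (\<forall>z\<in>set vs. r\<^sup>*\<^sup>* x z)"
  using assms
proof induction
  case base
  show ?case by (intro exI[of _ "[x]"]) simp
next
  case (step y z)
  then obtain vs where vs: "vs \<noteq> []" "distinct vs" "hd vs = x" "last vs = y" "successively r vs"
    "\<forall>z\<in>set vs. r\<^sup>*\<^sup>* x z" by blast
  show ?case
  proof (cases "z \<in> set vs")
    case True
    then obtain as bs where split: "vs = (as @ [z]) @ bs" by (metis split_list append_Cons append_Nil append_assoc)
    then have "successively r (as @ [z])" using vs(5) successively_append_iff by metis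
    then show ?thesis using vs(1-3,6) split
      by (intro exI[of _ "as @ [z]"]) (cases as; simp)
  next
    case False
    have "r\<^sup>*\<^sup>* x z" using step.hyps by (rule rtranclp.rtrancl_into_rtrancl)
    then show ?thesis using vs False step.hyps(2)
      by (intro exI[of _ "vs @ [z]"]) (auto simp: successively_append_iff)
  qed
qed

lemma adj_sym: "adj G u v \<Longrightarrow> adj G v u"
  by (simp add: adj_def insert_commute)

lemma adj_in: "is_graph G \<Longrightarrow> adj G u v \<Longrightarrow> u \<in> fst G \<and> v \<in> fst G \<and> u \<noteq> v"
  by (force simp: is_graph_def adj_def)

lemma adj_delete_iff:
  "adj (delete_vertices G S) u v \<longleftrightarrow> adj G u v \<and> u \<notin> S \<and> v \<notin> S"
  by (auto simp: adj_def delete_vertices_def)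

lemma finite_neighbours: "is_graph G \<Longrightarrow> finite {u. adj G v u}"
  by (rule finite_subset[of _ "fst G"]) (use adj_in[of G] in blast, simp add: is_graph_def)

lemma incident_edges:
  assumes "is_graph G"
  shows "{e \<in> snd G. v \<in> e} = (\<lambda>u. {v, u}) ` {u. adj G v u}"
proof (intro set_eqI iffI)
  fix e assume e: "e \<in> {e \<in> snd G. v \<in> e}"
  then have "card e = 2" using assms by (auto simp: is_graph_def)
  then obtain u where "e = {v, u}" using e by (auto simp: card_2_iff)
  then show "e \<in> (\<lambda>u. {v, u}) ` {u. adj G v u}" using e by (auto simp: adj_def)
qed (auto simp: adj_def)

lemma degree_eq_card_neighbours:
  assumes "is_graph G"
  shows "degree G v = card {u. adj G v u}"
  unfolding degree_def incident_edges[OF assms]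
  by (rule card_image) (auto simp: inj_on_def doubleton_eq_iff)

definition branch :: "'v graph \<Rightarrow> 'v \<Rightarrow> 'v \<Rightarrow> 'v set" where
  "branch G v u = {x. (adj (delete_vertices G {v}))\<^sup>*\<^sup>* u x}"

lemma branch_refl [simp]: "u \<in> branch G v u"
  by (simp add: branch_def)

lemma branch_subset:
  assumes "is_graph G" "adj G v u" "x \<in> branch G v u"
  shows "x \<in> fst G \<and> x \<noteq> v"
proof -
  have "(adj (delete_vertices G {v}))\<^sup>*\<^sup>* u x" using assms(3) by (simp add: branch_def)
  then show ?thesis
  proof cases
    case rtrancl_refl
    then show ?thesis using adj_in[OF assms(1,2)] by blast
  next
    case (rtrancl_into_rtrancl y)
    then show ?thesis using adj_in[OF assms(1), of y x] by (simp add: adj_delete_iff)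
  qed
qed

lemma branch_step:
  assumes "is_graph G" "adj G v u" "x \<in> branch G v u" "adj G x y" "y \<noteq> v"
  shows "y \<in> branch G v u"
  using branch_subset[OF assms(1-3)] assms(3-5)
  by (auto simp: branch_def adj_delete_iff intro: rtranclp.rtrancl_into_rtrancl)

text \<open>Otherwise a path from \<open>u\<close> to \<open>w\<close> avoiding \<open>v\<close>
  closes to a cycle through \<open>v\<close>.\<close>

lemma branch_neighbour_unique:
  assumes G: "is_graph G" and acyclic: "\<not> has_cycle G"
    and u: "adj G v u" and w: "adj G v w" and uw: "w \<in> branch G v u"
  shows "u = w"
proof (rule ccontr)
  assume "u \<noteq> w"
  let ?r = "adj (delete_vertices G {v})"
  obtain vs where vs: "vs \<noteq> []" "distinct vs" "hd vs = u" "last vs = w" "successively ?r vs"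
    "\<forall>z\<in>set vs. ?r\<^sup>*\<^sup>* u z"
    using rtranclp_distinct_path[of ?r u w] uw by (auto simp: branch_def)
  have sub: "\<forall>z\<in>set vs. z \<in> fst G \<and> z \<noteq> v"
    using vs(6) branch_subset[OF G u] by (simp add: branch_def)
  \<comment> \<open>With \<open>v\<close> appended this gives the three vertices that a cycle
    needs.\<close>
  have "length vs \<ge> 2"
    using vs(1,3,4) \<open>u \<noteq> w\<close> by (cases vs rule: list.exhaust; cases "tl vs") auto
  moreover have "successively (adj G) vs"
    using vs(5) by (rule successively_mono) (auto simp: adj_delete_iff)
  then have succ: "successively (adj G) (vs @ [v])"
    using vs(1,4) adj_sym[OF w] by (simp add: successively_append_iff)
  then have "\<forall>i < length (vs @ [v]) - 1. adj G ((vs @ [v]) ! i) ((vs @ [v]) ! (i + 1))"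
    unfolding successively_conv_nth by simp
  moreover have "v \<in> fst G" using adj_in[OF G u] by simp
  ultimately have "has_cycle G"
    unfolding has_cycle_def using vs(1-3) sub u by (intro exI[of _ "vs @ [v]"]) auto
  with acyclic show False ..
qed

lemma branch_disjoint:
  assumes G: "is_graph G" and acyclic: "\<not> has_cycle G"
    and u: "adj G v u" and w: "adj G v w" and "u \<noteq> w"
  shows "branch G v u \<inter> branch G v w = {}"
proof (rule ccontr)
  assume "\<not> ?thesis"
  then obtain x where "(adj (delete_vertices G {v}))\<^sup>*\<^sup>* u x" "(adj (delete_vertices G {v}))\<^sup>*\<^sup>* w x"
    by (auto simp: branch_def)
  then have "w \<in> branch G v u"
    unfolding branch_def mem_Collect_eq by (meson adj_sym rtranclp_sym rtranclp_trans)
  then show False using branch_neighbour_unique[OF G acyclic u w] \<open>u \<noteq> w\<close> by simp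
qed

text \<open>The only edge leaving a branch is the one to \<open>v\<close>; this supplies the cross
  conditions of \<open>branching\<close>.\<close>

lemma branch_exit:
  assumes G: "is_graph G" "\<not> has_cycle G" and u: "adj G v u"
    and x: "x \<in> branch G v u" and y: "y \<notin> branch G v u" and "adj G x y"
  shows "x = u \<and> y = v"
proof -
  have "y = v" using branch_step[OF G(1) u x \<open>adj G x y\<close>] y by blast
  moreover have "u = x" using branch_neighbour_unique[OF G u _ x] \<open>adj G x y\<close> \<open>y = v\<close> adj_sym[of G x y] by simp
  ultimately show ?thesis by simp
qed

text \<open>Both outer sets are \<open>{v}\<close> because adjacency is symmetric.\<close>

lemma branching_floor_str:
  assumes "is_tree G"
  shows "branching (floor_str G) {u. adj G v u} (branch G v) (\<lambda>u. {u}) {v} {v}"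
proof -
  have G: "is_graph G" "\<not> has_cycle G" using assms by (auto simp: is_tree_def)
  have ex: "adj G x y \<longleftrightarrow> x = u \<and> y = v" if "adj G v u" "x \<in> branch G v u" "y \<notin> branch G v u" for u x y
    using branch_exit[OF G that] adj_sym[OF that(1)] by blast
  show ?thesis
    unfolding branching_def floor_str_def fst_conv snd_conv
  proof (intro conjI ballI impI)
    fix u assume u: "u \<in> {u. adj G v u}"
    show "branch G v u \<noteq> {}" using branch_refl by (metis empty_iff)
    show "branch G v u \<subseteq> fst G" "branch G v u \<inter> {v} = {}" "branch G v u \<inter> {v} = {}"
      using branch_subset[OF G(1)] u by auto
    fix x y assume xy: "x \<in> branch G v u" "y \<in> fst G - branch G v u"
    show "adj G x y = (x \<in> {u} \<and> y \<in> {v})" using ex[of u x y] u xy by simp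
    show "adj G y x = (x \<in> {u} \<and> y \<in> {v})" using ex[of u x y] u xy adj_sym[of G x y] adj_sym[of G y x] by auto
  next
    fix u w assume "u \<in> {u. adj G v u}" "w \<in> {u. adj G v u}" "u \<noteq> w"
    then show "branch G v u \<inter> branch G v w = {}" using branch_disjoint[OF G] by simp
  qed
qed

text \<open>The connecting edge \<open>{v, u}\<close> is counted in as well, so that a vertex of the
  branch has all its incident edges inside.\<close>

definition edge_branch :: "'v graph \<Rightarrow> 'v \<Rightarrow> 'v \<Rightarrow> ('v + 'v set) set" where
  "edge_branch G v u = Inl ` branch G v u \<union> Inr ` {e \<in> snd G. e \<inter> branch G v u \<noteq> {}}"

text \<open>The only contact with the outside is that \<open>v\<close> is incident with the edge
  \<open>{v, u}\<close>. It points into the branch, so the set for outgoing contacts is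
  empty.\<close>

lemma branching_ceil_str:
  assumes "is_tree G"
  shows "branching (ceil_str G) {u. adj G v u} (edge_branch G v) (\<lambda>u. {Inr {v, u}}) {} {Inl v}"
proof -
  have G: "is_graph G" "\<not> has_cycle G" using assms by (auto simp: is_tree_def)
  have edge: "adj G x y" if "e \<in> snd G" "x \<in> e" "y \<in> e" "x \<noteq> y" for e x y
  proof -
    have "card e = 2" using G(1) that(1) by (auto simp: is_graph_def)
    then have "e = {x, y}" using that by (auto simp: card_2_iff)
    then show ?thesis using that(1) by (simp add: adj_def)
  qed
  have eV: "x \<in> fst G" if "e \<in> snd G" "x \<in> e" for e x
    using G(1) that by (auto simp: is_graph_def)
  show ?thesis
    unfolding branching_def
  proof (intro conjI ballI impI)
    fix u assume "u \<in> {u. adj G v u}"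
    then have u: "adj G v u" by simp
    have sub: "x \<in> fst G" "x \<noteq> v" if "x \<in> branch G v u" for x
      using branch_subset[OF G(1) u that] by auto
    show "edge_branch G v u \<noteq> {}" using branch_refl[of u G v] by (auto simp: edge_branch_def simp del: branch_refl)
    show "edge_branch G v u \<subseteq> fst (ceil_str G)" using sub by (auto simp: edge_branch_def ceil_str_def)
    show "edge_branch G v u \<inter> {} = {}" by simp
    show "edge_branch G v u \<inter> {Inl v} = {}" using sub by (auto simp: edge_branch_def)
    fix x y assume x: "x \<in> edge_branch G v u" and y: "y \<in> fst (ceil_str G) - edge_branch G v u"
    show "snd (ceil_str G) x y = (x \<in> {Inr {v, u}} \<and> y \<in> {})"
      using x y by (auto simp: edge_branch_def ceil_str_def)
    show "snd (ceil_str G) y x = (x \<in> {Inr {v, u}} \<and> y \<in> {Inl v})"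
    proof
      assume "snd (ceil_str G) y x"
      then obtain z e where ze: "y = Inl z" "x = Inr e" "e \<in> snd G" "z \<in> e"
        by (auto simp: ceil_str_def)
      then have z: "z \<notin> branch G v u" using y by (auto simp: edge_branch_def)
      obtain t where t: "t \<in> e" "t \<in> branch G v u" using x ze by (auto simp: edge_branch_def)
      then have "adj G t z" using edge ze z by metis
      then have tz: "t = u" "z = v" using branch_exit[OF G u t(2) z] by auto
      have "card e = 2" using G(1) ze by (auto simp: is_graph_def)
      then have "e = {v, u}" using t ze tz adj_in[OF G(1) u] by (auto simp: card_2_iff)
      then show "x \<in> {Inr {v, u}} \<and> y \<in> {Inl v}" using ze tz by simp
    next
      assume "x \<in> {Inr {v, u}} \<and> y \<in> {Inl v}"
      then show "snd (ceil_str G) y x"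
        using u adj_in[OF G(1) u] by (auto simp: ceil_str_def adj_def)
    qed
  next
    fix u w assume "u \<in> {u. adj G v u}" "w \<in> {u. adj G v u}" and uw: "u \<noteq> w"
    then have u: "adj G v u" and w: "adj G v w" by auto
    note disj = branch_disjoint[OF G u w uw]
    \<comment> \<open>An edge meeting both branches would leave the first one and so end in
      \<open>v\<close>, which lies in no branch.\<close>
    have False if e: "e \<in> snd G" "x \<in> e" "y \<in> e" "x \<in> branch G v u" "y \<in> branch G v w" for e x y
    proof -
      have "x \<noteq> y" "y \<notin> branch G v u" using disj e by auto
      then have "y = v" using branch_exit[OF G u e(4)] edge e by blast
      then show False using branch_subset[OF G(1) w e(5)] by simp
    qed
    then show "edge_branch G v u \<inter> edge_branch G v w = {}"
      using disj unfolding edge_branch_def by blast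
  qed
qed

section \<open>Degrees and separation numbers\<close>

lemma finite_Sep_set:
  "finite (fst G) \<Longrightarrow> finite {card (components (delete_vertices G S)) | S. S \<subseteq> fst G \<and> card S \<le> k}"
  by (rule finite_subset[of _ "(\<lambda>S. card (components (delete_vertices G S))) ` Pow (fst G)"]) auto

lemma degree_le_Sep:
  assumes "is_tree G" "v \<in> fst G"
  shows "degree G v \<le> Sep G 1"
proof -
  have G: "is_graph G" "\<not> has_cycle G" and fin: "finite (fst G)"
    using assms by (auto simp: is_tree_def is_graph_def)
  let ?H = "delete_vertices G {v}"
  let ?r = "{(x, y). x \<in> fst ?H \<and> y \<in> fst ?H \<and> (adj ?H)\<^sup>*\<^sup>* x y}"
  have fH: "fst ?H = fst G - {v}" by (simp add: delete_vertices_def)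
  have nb: "u \<in> fst ?H" if "adj G v u" for u using adj_in[OF G(1) that] fH by auto
  have "degree G v = card {u. adj G v u}" by (rule degree_eq_card_neighbours[OF G(1)])
  also have "\<dots> \<le> card (components ?H)"
  proof (rule card_inj_on_le)
    show "inj_on (\<lambda>u. ?r `` {u}) {u. adj G v u}"
    proof (rule inj_onI)
      fix u w assume "u \<in> {u. adj G v u}" "w \<in> {u. adj G v u}" and eq: "?r `` {u} = ?r `` {w}"
      then have uw: "adj G v u" "adj G v w" by auto
      have "w \<in> ?r `` {w}" using nb[OF uw(2)] by auto
      then have "w \<in> ?r `` {u}" using eq by simp
      then have "w \<in> branch G v u" by (simp add: branch_def)
      then show "u = w" by (rule branch_neighbour_unique[OF G uw])
    qed
    show "(\<lambda>u. ?r `` {u}) ` {u. adj G v u} \<subseteq> components ?H"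
      unfolding components_def using nb by (intro image_subsetI quotientI) simp
    have "?r \<subseteq> fst ?H \<times> fst ?H" by auto
    then show "finite (components ?H)"
      unfolding components_def using fin fH by (intro finite_quotient) auto
  qed
  also have "\<dots> \<le> Sep G 1"
    unfolding Sep_def using assms(2) by (intro Max_ge finite_Sep_set fin) (auto intro!: exI[of _ "{v}"])
  finally show ?thesis .
qed

text \<open>By connectedness, every component left by a non-empty \<open>S\<close> contains a
  neighbour of \<open>S\<close>, and there are at most \<open>k * d\<close> of these. The extra 1
  covers \<open>S = {}\<close>, where \<open>fst G\<close> is the only component.\<close>

lemma Sep_le_degree:
  assumes "is_tree G" and deg: "\<forall>v\<in>fst G. degree G v \<le> d"
  shows "Sep G k \<le> Suc (k * d)"
proof -
  have G: "is_graph G" "connected G" and fin: "finite (fst G)"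
    using assms by (auto simp: is_tree_def is_graph_def)
  have bound: "card (components (delete_vertices G S)) \<le> Suc (k * d)"
    if S: "S \<subseteq> fst G" "card S \<le> k" for S
  proof -
    let ?H = "delete_vertices G S"
    define r where "r = {(x, y). x \<in> fst ?H \<and> y \<in> fst ?H \<and> (adj ?H)\<^sup>*\<^sup>* x y}"
    have fH: "fst ?H = fst G - S" by (simp add: delete_vertices_def)
    let ?N = "\<Union>s\<in>S. {y. adj G s y}"
    have fS: "finite S" using S(1) fin by (rule finite_subset)
    have "components ?H \<subseteq> insert (fst G) ((\<lambda>y. r `` {y}) ` ?N)"
    proof
      fix Q assume "Q \<in> components ?H"
      then obtain x where x: "x \<in> fst ?H" "Q = r `` {x}"
        unfolding components_def r_def by (auto elim: quotientE)
      show "Q \<in> insert (fst G) ((\<lambda>y. r `` {y}) ` ?N)"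
      proof (cases "S = {}")
        case True
        then have "adj ?H = adj G" by (simp add: fun_eq_iff adj_delete_iff)
        then have "Q = fst G" using x fH True G(2) by (auto simp: r_def connected_def)
        then show ?thesis by simp
      next
        case False
        then obtain s0 where "s0 \<in> S" by blast
        then have "(adj G)\<^sup>*\<^sup>* x s0" using x fH S G(2) by (auto simp: connected_def)
        moreover have "x \<notin> S" using x fH by simp
        \<comment> \<open>On a walk from \<open>x\<close> to \<open>s0\<close>, the vertex just
          before the first visit to \<open>S\<close> is still reachable in
          \<open>?H\<close>.\<close>
        ultimately have "\<exists>y s. (adj ?H)\<^sup>*\<^sup>* x y \<and> y \<notin> S \<and> s \<in> S \<and> adj G s y"
        proof (induction rule: converse_rtranclp_induct)
          case base
          then show ?case using \<open>s0 \<in> S\<close> by simp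
        next
          case (step x x')
          show ?case
          proof (cases "x' \<in> S")
            case True
            then show ?thesis using step.prems adj_sym[OF step.hyps(1)] by blast
          next
            case False
            then have "adj ?H x x'" using step by (simp add: adj_delete_iff)
            then show ?thesis using step.IH[OF False] by (meson converse_rtranclp_into_rtranclp)
          qed
        qed
        then obtain y s where ys: "(adj ?H)\<^sup>*\<^sup>* x y" "y \<notin> S" "s \<in> S" "adj G s y" by blast
        have "(adj ?H)\<^sup>*\<^sup>* y x" using ys(1) by (rule rtranclp_sym) (rule adj_sym)
        moreover have "y \<in> fst ?H" using adj_in[OF G(1) ys(4)] ys(2) fH by simp
        ultimately have "r `` {x} = r `` {y}"
          using ys(1) x(1) unfolding r_def by (auto intro: rtranclp_trans)
        then show ?thesis using x(2) ys by blast
      qed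
    qed
    moreover have finN: "finite ?N" using fS finite_neighbours[OF G(1)] by blast
    ultimately have "card (components ?H) \<le> card (insert (fst G) ((\<lambda>y. r `` {y}) ` ?N))"
      by (intro card_mono) auto
    also have "\<dots> \<le> Suc (card ((\<lambda>y. r `` {y}) ` ?N))" by (rule card_insert_le_m1) auto
    also have "card ((\<lambda>y. r `` {y}) ` ?N) \<le> card ?N" by (rule card_image_le[OF finN])
    also have "card ?N \<le> (\<Sum>s\<in>S. card {y. adj G s y})" by (rule card_UN_le[OF fS])
    also have "\<dots> \<le> (\<Sum>s\<in>S. d)"
      using deg S(1) degree_eq_card_neighbours[OF G(1)] by (intro sum_mono) (metis subsetD)
    also have "\<dots> \<le> k * d" using S(2) by simp
    finally show ?thesis by simp
  qed
  \<comment> \<open>The empty set shows that the maximum is taken over a non-empty set.\<close>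
  have "card (components (delete_vertices G {})) \<in>
      {card (components (delete_vertices G S)) | S. S \<subseteq> fst G \<and> card S \<le> k}"
    by (auto intro!: exI[of _ "{}"])
  then show ?thesis
    unfolding Sep_def using bound finite_Sep_set[OF fin] by (intro Max.boundedI) blast+
qed

section \<open>Application to both structures of a tree\<close>

lemma floor_str_orderable:
  assumes T: "\<forall>G\<in>T. is_tree G" and deg: "\<forall>G\<in>T. \<forall>v\<in>fst G. degree G v \<le> d"
  shows "MSO1_orderable T"
  unfolding MSO1_orderable_def
proof (rule bounded_degree_orderable[where d = d])
  fix S assume "S \<in> floor_str ` T"
  then obtain G where G: "G \<in> T" "S = floor_str G" by blast
  then have gr: "is_graph G" "connected G" using T by (auto simp: is_tree_def)
  have nb: "nbr S = adj G"
    using adj_in[OF gr(1)] adj_sym[of G] by (auto simp: fun_eq_iff nbr_def G floor_str_def)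
  show "finite (fst S)" using gr by (simp add: G floor_str_def is_graph_def)
  fix a assume a: "a \<in> fst S"
  then show "card {b. nbr S a b} \<le> d"
    unfolding nb degree_eq_card_neighbours[OF gr(1), symmetric] using deg G by (simp add: floor_str_def)
  fix b assume "b \<in> fst S"
  with a show "(nbr S)\<^sup>*\<^sup>* a b" unfolding nb using gr(2) by (simp add: G floor_str_def connected_def)
qed

lemma ceil_str_orderable:
  assumes T: "\<forall>G\<in>T. is_tree G" and deg: "\<forall>G\<in>T. \<forall>v\<in>fst G. degree G v \<le> d"
  shows "MSO2_orderable T"
  unfolding MSO2_orderable_def
\<comment> \<open>A vertex has at most \<open>d\<close> incident edges and an edge at most 2
  endpoints; the sum bounds both.\<close>
proof (rule bounded_degree_orderable[where d = "d + 2"])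
  fix S :: "('a + 'a set) mstruct" assume "S \<in> ceil_str ` T"
  then obtain G where G: "G \<in> T" "S = ceil_str G" by blast
  then have gr: "is_graph G" "connected G" "finite (fst G)" using T by (auto simp: is_tree_def is_graph_def)
  have e2: "card e = 2" "e \<subseteq> fst G" if "e \<in> snd G" for e using gr(1) that by (auto simp: is_graph_def)
  have U: "fst S = Inl ` fst G \<union> Inr ` snd G" by (simp add: G ceil_str_def)
  have nb: "nbr S (Inl v) (Inr e)" "nbr S (Inr e) (Inl v)" if "e \<in> snd G" "v \<in> e" for v e
    using that e2 by (auto simp: nbr_def G ceil_str_def)
  have "snd G \<subseteq> Pow (fst G)" using e2 by auto
  then have finE: "finite (snd G)" using gr(3) by (meson finite_Pow_iff finite_subset)
  then show "finite (fst S)" using gr U by simp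
  have step: "(nbr S)\<^sup>*\<^sup>* (Inl u) (Inl w)" if "adj G u w" for u w
  proof -
    have "nbr S (Inl u) (Inr {u, w})" "nbr S (Inr {u, w}) (Inl w)"
      using nb that by (auto simp: adj_def)
    then show ?thesis by (meson converse_rtranclp_into_rtranclp r_into_rtranclp)
  qed
  have vv: "(nbr S)\<^sup>*\<^sup>* (Inl u) (Inl w)" if "u \<in> fst G" "w \<in> fst G" for u w
  proof -
    have "(adj G)\<^sup>*\<^sup>* u w" using gr(2) that by (simp add: connected_def)
    then show ?thesis by induction (auto intro: rtranclp_trans step)
  qed
  \<comment> \<open>Every element is a vertex or touches one, so connectedness reduces to pairs of
    vertices.\<close>
  have near: "\<exists>v\<in>fst G. (nbr S)\<^sup>*\<^sup>* a (Inl v) \<and> (nbr S)\<^sup>*\<^sup>* (Inl v) a" if "a \<in> fst S" for a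
  proof (cases a)
    case (Inl v)
    then show ?thesis using that U by auto
  next
    case (Inr e)
    then have e: "e \<in> snd G" using that U by auto
    then obtain v where "v \<in> e" using e2[OF e] by fastforce
    then show ?thesis using nb[OF e] e2[OF e] Inr by blast
  qed
  fix a assume a: "a \<in> fst S"
  show "card {b. nbr S a b} \<le> d + 2"
  proof (cases a)
    case (Inl v)
    have "{b. nbr S a b} \<subseteq> Inr ` {e \<in> snd G. v \<in> e}"
      unfolding Inl by (auto simp: nbr_def G ceil_str_def)
    then have "card {b. nbr S a b} \<le> card {e \<in> snd G. v \<in> e}"
      using finE by (intro surj_card_le) auto
    moreover have "degree G v \<le> d" using deg G a Inl U by auto
    ultimately show ?thesis by (simp add: degree_def)
  next
    case (Inr e)
    then have e: "e \<in> snd G" using a U by auto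
    have "{b. nbr S a b} \<subseteq> Inl ` e"
      unfolding Inr by (auto simp: nbr_def G ceil_str_def)
    then have "card {b. nbr S a b} \<le> card e"
      using e2[OF e] gr(3) by (intro surj_card_le) (auto intro: finite_subset)
    then show ?thesis using e2[OF e] by simp
  qed
  fix b assume "b \<in> fst S"
  then show "(nbr S)\<^sup>*\<^sup>* a b" using near[OF a] near[of b] vv by (meson rtranclp_trans)
qed

text \<open>Branches at \<open>v\<close> are indexed by the neighbours of \<open>v\<close>, so the
  bound on branchings bounds the degree.\<close>

lemma orderable_bounded_degree:
  assumes T: "\<forall>G\<in>T. is_tree G"
  shows "MSO1_orderable T \<Longrightarrow> \<exists>d. \<forall>G\<in>T. \<forall>v\<in>fst G. degree G v \<le> d"
    and "MSO2_orderable T \<Longrightarrow> \<exists>d. \<forall>G\<in>T. \<forall>v\<in>fst G. degree G v \<le> d"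
proof -
  have gr: "is_graph G" if "G \<in> T" for G using T that by (auto simp: is_tree_def)
  show "\<exists>d. \<forall>G\<in>T. \<forall>v\<in>fst G. degree G v \<le> d" if "MSO1_orderable T"
  proof -
    obtain d where d: "\<And>S (J :: 'a set) A M N N'.
        S \<in> floor_str ` T \<Longrightarrow> branching S J A M N N' \<Longrightarrow> finite J \<Longrightarrow> card J \<le> d"
      using orderable_branching_bound[OF \<open>MSO1_orderable T\<close>[unfolded MSO1_orderable_def], where 'i = 'a]
      by blast
    then have "degree G v \<le> d" if "G \<in> T" for G v
      using d[OF imageI[OF that] branching_floor_str finite_neighbours[OF gr[OF that]]] T that
        degree_eq_card_neighbours[OF gr[OF that]] by simp
    then show ?thesis by blast
  qed
  show "\<exists>d. \<forall>G\<in>T. \<forall>v\<in>fst G. degree G v \<le> d" if "MSO2_orderable T"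
  proof -
    obtain d where d: "\<And>S (J :: 'a set) A M N N'.
        S \<in> ceil_str ` T \<Longrightarrow> branching S J A M N N' \<Longrightarrow> finite J \<Longrightarrow> card J \<le> d"
      using orderable_branching_bound[OF \<open>MSO2_orderable T\<close>[unfolded MSO2_orderable_def], where 'i = 'a]
      by blast
    then have "degree G v \<le> d" if "G \<in> T" for G v
      using d[OF imageI[OF that] branching_ceil_str finite_neighbours[OF gr[OF that]]] T that
        degree_eq_card_neighbours[OF gr[OF that]] by simp
    then show ?thesis by blast
  qed
qed

theorem theorem4p8:
  fixes T :: "'v graph set"
  assumes "\<forall>G\<in>T. is_tree G"
  shows "(MSO1_orderable T \<longleftrightarrow> MSO2_orderable T) \<and>
         (MSO2_orderable T \<longleftrightarrow> has_SEP T) \<and>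
         (has_SEP T \<longleftrightarrow> (\<exists>d::nat. \<forall>G\<in>T. \<forall>v\<in>fst G. degree G v \<le> d))"
proof -
  \<comment> \<open>Each of the other three conditions is compared with bounded degree only.\<close>
  let ?D = "\<exists>d::nat. \<forall>G\<in>T. \<forall>v\<in>fst G. degree G v \<le> d"
  have "MSO1_orderable T \<longleftrightarrow> ?D"
    using orderable_bounded_degree(1)[OF assms] floor_str_orderable[OF assms] by blast
  moreover have "MSO2_orderable T \<longleftrightarrow> ?D"
    using orderable_bounded_degree(2)[OF assms] ceil_str_orderable[OF assms] by blast
  moreover have "has_SEP T \<longleftrightarrow> ?D"
  proof
    assume "has_SEP T"
    then obtain f where "\<forall>G\<in>T. \<forall>k. Sep G k \<le> f k" by (auto simp: has_SEP_def)
    then have "\<forall>G\<in>T. \<forall>v\<in>fst G. degree G v \<le> f 1"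
      using degree_le_Sep assms by (meson order_trans)
    then show ?D by blast
  next
    assume ?D
    then obtain d where "\<forall>G\<in>T. \<forall>v\<in>fst G. degree G v \<le> d" by blast
    then show "has_SEP T"
      unfolding has_SEP_def using Sep_le_degree assms by (intro exI[of _ "\<lambda>k. Suc (k * d)"]) blast
  qed
  ultimately show ?thesis by simp
qed

end
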